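(* Let $\alpha$ be a $C^2$ regular curve, parametrized by arc-length, in $\mathbb{S}^{m+1}(r)$ or $\mathbb{H}^{m+1}(r)$, and let $\{\mathbf t,\mathbf n_1,\dots,\mathbf n_m\}$ be a rotation minimizing frame along it. Then $\alpha$ is a plane curve, i.e. it lies on a (proper) totally geodesic submanifold, if and only if the normal development $(\kappa_1,\dots,\kappa_m)$ lies on a line passing through the origin, i.e. $\sum_{i=1}^m a_i\kappa_i=0$ along $\alpha$ for some constants $a_1,\dots,a_m$, not all zero.
   Context: $\mathbb{S}^{m+1}(r)=\{q\in\mathbb{R}^{m+2}:\langle q,q\rangle_e=r^2\}$ with the metric induced by the Euclidean inner product, and $\mathbb{H}^{m+1}(r)=\{q\in\mathbb{R}^{m+2}:\langle q,q\rangle_1=-r^2,\ q_1>0\}$ with the metric induced by $\langle x,y\rangle_1=-x_1y_1+\sum_{i\ge2}x_iy_i$; $\nabla$ is the Levi-Civita connection. A rotation minimizing frame along $\alpha$ is an orthonormal frame of tangent vectors to the ambient manifold with $\mathbf t=\alpha'$ and $\nabla_{\mathbf t}\mathbf n_i=-\kappa_i\mathbf t$; then $\nabla_{\mathbf t}\mathbf t=\sum_i\kappa_i\mathbf n_i$. The curve $(\kappa_1,\dots,\kappa_m)$ is the normal development. A submanifold is totally geodesic if every geodesic of it is a geodesic of the ambient manifold; in these spaces totally geodesic submanifolds are (open pieces of) the intersections with linear subspaces of $\mathbb{R}^{m+2}$. "Line passing through the origin" means the locus $\{\sum_ia_iX_i=0\}\subset\mathbb{R}^m$ (a line when $m=2$).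 *)

theory Defs
  imports "HOL-Analysis.Analysis"
begin

text \<open>The sphere of radius \<open>r\<close> is the library's \<open>sphere 0 r\<close> with the bilinear form
  \<open>inner\<close>. The time-like coordinate of the Lorentzian form, usually the first
  one, is an arbitrary distinguished index \<open>i0\<close>.\<close>

definition lorentz :: "'n::finite \<Rightarrow> real ^ 'n \<Rightarrow> real ^ 'n \<Rightarrow> real" where
  "lorentz i0 x y = - (x $ i0 * y $ i0) + (\<Sum>i\<in>UNIV - {i0}. x $ i * y $ i)"

definition hyperbolic_space :: "'n::finite \<Rightarrow> real \<Rightarrow> (real ^ 'n) set" where
  "hyperbolic_space i0 r = {q. lorentz i0 q q = - r\<^sup>2 \<and> q $ i0 > 0}"

text \<open>\<open>Ck_on k f U\<close> is meant for open \<open>U\<close>.\<close>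

primrec Ck_on ::
    "nat \<Rightarrow> ('a::euclidean_space \<Rightarrow> 'b::real_normed_vector) \<Rightarrow> 'a set \<Rightarrow> bool" where
  "Ck_on 0 f U \<longleftrightarrow> continuous_on U f"
| "Ck_on (Suc k) f U \<longleftrightarrow>
     (\<forall>x\<in>U. f differentiable (at x)) \<and>
     (\<forall>b\<in>Basis. Ck_on k (\<lambda>x. frechet_derivative f (at x) b) U)"

definition smooth_map_on ::
    "('a::euclidean_space \<Rightarrow> 'b::real_normed_vector) \<Rightarrow> 'a set \<Rightarrow> bool" where
  "smooth_map_on f U \<longleftrightarrow> (\<forall>k. Ck_on k f U)"

definition diffeomorphism_between ::
    "'a::euclidean_space set \<Rightarrow> 'b::euclidean_space set \<Rightarrow> ('a \<Rightarrow> 'b) \<Rightarrow> bool" where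
  "diffeomorphism_between U V \<Phi> \<longleftrightarrow>
     open U \<and> open V \<and> smooth_map_on \<Phi> U \<and>
     (\<exists>\<Psi>. homeomorphism U V \<Phi> \<Psi> \<and> smooth_map_on \<Psi> V)"

definition submanifold :: "nat \<Rightarrow> 'a::euclidean_space set \<Rightarrow> bool" where
  "submanifold k S \<longleftrightarrow>
     (\<forall>p\<in>S. \<exists>U V \<Phi> E. p \<in> U \<and> diffeomorphism_between U V (\<Phi> :: 'a \<Rightarrow> 'a) \<and>
        subspace E \<and> dim E = k \<and> \<Phi> ` (S \<inter> U) = E \<inter> V)"

text \<open>Velocities of curves in \<open>S\<close> through \<open>p\<close>. For an embedded submanifold it does not
  matter that the curves are only required to be differentiable at the parameter \<open>0\<close>.\<close>

definition tangent_space :: "'a::real_normed_vector set \<Rightarrow> 'a \<Rightarrow> 'a set" where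
  "tangent_space S p =
     {v. \<exists>c e. e > 0 \<and> (\<forall>s. \<bar>s\<bar> < e \<longrightarrow> c s \<in> S) \<and> c (0::real) = p \<and>
           (c has_vector_derivative v) (at 0)}"

text \<open>Parameter domains may contain their end points, where derivatives are one-sided.\<close>

definition parameter_interval :: "real set \<Rightarrow> bool" where
  "parameter_interval I \<longleftrightarrow> is_interval I \<and> interior I \<noteq> {}"

definition C2_curve :: "real set \<Rightarrow> (real \<Rightarrow> 'a::real_normed_vector) \<Rightarrow> bool" where
  "C2_curve I \<alpha> \<longleftrightarrow>
     (\<exists>\<alpha>' \<alpha>''. (\<forall>s\<in>I. (\<alpha> has_vector_derivative \<alpha>' s) (at s within I)) \<and>
             (\<forall>s\<in>I. (\<alpha>' has_vector_derivative \<alpha>'' s) (at s within I)) \<and>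
             continuous_on I \<alpha>'')"

definition unit_speed ::
    "('a \<Rightarrow> 'a \<Rightarrow> real) \<Rightarrow> real set \<Rightarrow> (real \<Rightarrow> 'a::real_normed_vector) \<Rightarrow> bool" where
  "unit_speed B I \<alpha> \<longleftrightarrow>
     (\<forall>s\<in>I. \<exists>v. (\<alpha> has_vector_derivative v) (at s within I) \<and> B v v = 1)"

text \<open>\<open>W\<close> is the covariant derivative at \<open>s\<close>, along the curve \<open>\<alpha>\<close> in \<open>S\<close>, of the vector field
  \<open>V\<close>. The Levi-Civita connection of the metric induced on \<open>S\<close> by a constant symmetric bilinear
  form \<open>B\<close> is the \<open>B\<close>-orthogonal projection to the tangent space of \<open>S\<close> of the derivative in
  the surrounding vector space.\<close>

definition has_covariant_derivative ::
    "('a \<Rightarrow> 'a \<Rightarrow> real) \<Rightarrow> 'a set \<Rightarrow> real set \<Rightarrow> (real \<Rightarrow> 'a) \<Rightarrow>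
      (real \<Rightarrow> 'a::real_normed_vector) \<Rightarrow> 'a \<Rightarrow> real \<Rightarrow> bool" where
  "has_covariant_derivative B S I \<alpha> V W s \<longleftrightarrow>
     W \<in> tangent_space S (\<alpha> s) \<and>
     (\<exists>D. (V has_vector_derivative D) (at s within I) \<and>
          (\<forall>u\<in>tangent_space S (\<alpha> s). B (D - W) u = 0))"

definition geodesic ::
    "('a \<Rightarrow> 'a \<Rightarrow> real) \<Rightarrow> 'a set \<Rightarrow> real set \<Rightarrow> (real \<Rightarrow> 'a::real_normed_vector) \<Rightarrow> bool" where
  "geodesic B S J \<gamma> \<longleftrightarrow>
     parameter_interval J \<and> \<gamma> ` J \<subseteq> S \<and> C2_curve J \<gamma> \<and>
     (\<exists>\<gamma>'. \<forall>s\<in>J. (\<gamma> has_vector_derivative \<gamma>' s) (at s within J) \<and>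
                has_covariant_derivative B S J \<gamma> \<gamma>' 0 s)"

definition totally_geodesic_submanifold ::
    "('a \<Rightarrow> 'a \<Rightarrow> real) \<Rightarrow> 'a set \<Rightarrow> nat \<Rightarrow> 'a::euclidean_space set \<Rightarrow> bool" where
  "totally_geodesic_submanifold B M k S \<longleftrightarrow>
     S \<subseteq> M \<and> submanifold k S \<and> (\<forall>J \<gamma>. geodesic B S J \<gamma> \<longrightarrow> geodesic B M J \<gamma>)"

text \<open>\<open>d\<close> is the dimension of \<open>M\<close>. A proper submanifold has positive codimension: every curve
  lies on the open subset \<open>M\<close> of \<open>M\<close>.\<close>

definition plane_curve ::
    "('a \<Rightarrow> 'a \<Rightarrow> real) \<Rightarrow> 'a set \<Rightarrow> nat \<Rightarrow> real set \<Rightarrow> (real \<Rightarrow> 'a::euclidean_space) \<Rightarrow> bool"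
  where
  "plane_curve B M d I \<alpha> \<longleftrightarrow>
     (\<exists>k S. k < d \<and> totally_geodesic_submanifold B M k S \<and> \<alpha> ` I \<subseteq> S)"

definition rotation_minimizing_frame ::
    "('a \<Rightarrow> 'a \<Rightarrow> real) \<Rightarrow> 'a set \<Rightarrow> nat \<Rightarrow> real set \<Rightarrow> (real \<Rightarrow> 'a::real_normed_vector) \<Rightarrow>
      (real \<Rightarrow> 'a) \<Rightarrow> (nat \<Rightarrow> real \<Rightarrow> 'a) \<Rightarrow> (nat \<Rightarrow> real \<Rightarrow> real) \<Rightarrow> bool" where
  "rotation_minimizing_frame B M m I \<alpha> t n \<kappa> \<longleftrightarrow>
     (\<forall>s\<in>I. (\<alpha> has_vector_derivative t s) (at s within I) \<and>
        span (insert (t s) ((\<lambda>i. n i s) ` {1..m})) = tangent_space M (\<alpha> s) \<and>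
        B (t s) (t s) = 1 \<and>
        (\<forall>i\<in>{1..m}. B (t s) (n i s) = 0) \<and>
        (\<forall>i\<in>{1..m}. \<forall>j\<in>{1..m}. B (n i s) (n j s) = (if i = j then 1 else 0)) \<and>
        (\<forall>i\<in>{1..m}. has_covariant_derivative B M I \<alpha> (n i) (- \<kappa> i s *\<^sub>R t s) s))"

end

theory Submission
  imports Defs
begin

text \<open>Both ambient spaces are quadrics: \<open>M\<close> is the part of \<open>{q. B q q = \<beta>}\<close> in an open set, where
  \<open>B\<close> is positive definite on the \<open>B\<close>-orthogonal complement of each point of \<open>M\<close>. This complement
  is the tangent space, and the line through the point is normal. The whole proof uses only this
  (locale \<open>space_form\<close>); sphere and hyperbolic space are instances.

  Since a frame field \<open>n i\<close> stays orthogonal to \<open>\<alpha>\<close> and to \<open>t\<close>, its derivative in the surrounding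
  vector space has no component along \<open>\<alpha>\<close>, and the frame equation becomes \<open>n i' = - \<kappa> i t\<close>
  there (\<open>frame_derivative\<close>). So if \<open>\<Sum> a i \<kappa> i = 0\<close>, then \<open>N = \<Sum> a i n i\<close> is a constant
  vector orthogonal to \<open>\<alpha>\<close>, and \<open>\<alpha>\<close> lies on the section of \<open>M\<close> by the hyperplane orthogonal to
  \<open>N\<close>, which is a totally geodesic submanifold of codimension one. Conversely, if a constant vector
  \<open>N \<noteq> 0\<close> is orthogonal to \<open>\<alpha>\<close>, then it is orthogonal to \<open>t\<close>, so \<open>a i = B N (n i)\<close> is constant
  and \<open>N = \<Sum> a i n i\<close>; pairing \<open>N\<close> with \<open>t'\<close> gives \<open>\<Sum> a i \<kappa> i = 0\<close>.

  What remains is to find such an \<open>N\<close> when \<open>\<alpha>\<close> lies on a totally geodesic submanifold \<open>S\<close> of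
  dimension at most \<open>m\<close>. The span of \<open>p\<close> and \<open>T\<^sub>pS\<close> has codimension at least one; the claim is that
  it does not change locally along \<open>S\<close>, so that any \<open>N\<close> orthogonal to it at one point of \<open>\<alpha>\<close> is
  orthogonal to it along all of \<open>\<alpha>\<close>. Take a parametrization \<open>\<Psi>\<close> of \<open>S\<close> by a linear
  subspace. Through each point of \<open>S\<close> there is a geodesic of \<open>S\<close> with any prescribed velocity, because
  the geodesic equation is an ordinary differential equation with Lipschitz right-hand side
  (\<open>geodesic_exists\<close>). It is a geodesic of \<open>M\<close>, so its acceleration is normal to \<open>M\<close>; hence
  the second derivative of \<open>\<Psi>\<close> on the diagonal, and by polarization everywhere, takes values in
  the span of \<open>p\<close> and \<open>T\<^sub>pS\<close> (\<open>D2_in_osc\<close>). Along a segment in the parameter domain, the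
  components of \<open>N\<close> along this span therefore satisfy a homogeneous linear differential inequality, and
  Gronwall's lemma shows that they vanish identically once they vanish at one end
  (\<open>osc_orthogonal_propagates\<close>).\<close>

section \<open>Calculus of continuously differentiable maps\<close>

text \<open>The recursion equation would unfold smoothness of every positive order into partial derivatives;
  \<open>Ck_on_SucI\<close> and \<open>Ck_on_SucD\<close> apply it in a controlled way.\<close>

declare Ck_on.simps(2) [simp del]

lemma Ck_on_cong:
  assumes "open U" "\<And>x. x \<in> U \<Longrightarrow> f x = g x" "Ck_on k f U"
  shows "Ck_on k g U"
  using assms(2,3)
proof (induction k arbitrary: f g)
  case 0
  then show ?case by (simp cong: continuous_on_cong)
next
  case (Suc k)
  have "g differentiable (at x) \<and> frechet_derivative f (at x) = frechet_derivative g (at x)" if "x \<in> U" for x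
  proof -
    have f: "(f has_derivative frechet_derivative f (at x)) (at x)"
      using Suc.prems(2) that by (simp add: Ck_on.simps(2) frechet_derivative_works)
    have "(g has_derivative frechet_derivative f (at x)) (at x)"
      by (rule has_derivative_transform_within_open[OF f \<open>open U\<close> that]) (use Suc.prems(1) in auto)
    then show ?thesis
      using frechet_derivative_at differentiable_def by blast
  qed
  then show ?case
    using Suc.prems(2) Suc.IH[of "\<lambda>x. frechet_derivative f (at x) _" "\<lambda>x. frechet_derivative g (at x) _"]
    by (auto simp: Ck_on.simps(2))
qed

text \<open>Any family of derivatives may replace \<open>frechet_derivative\<close>. The rule makes closure
  properties of \<open>Ck_on\<close> provable by induction from the usual differentiation rules.\<close>

lemma Ck_on_SucI:
  assumes "open U" "\<And>x. x \<in> U \<Longrightarrow> (f has_derivative f' x) (at x)"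
    "\<And>b. b \<in> Basis \<Longrightarrow> Ck_on k (\<lambda>x. f' x b) U"
  shows "Ck_on (Suc k) f U"
proof -
  have "frechet_derivative f (at x) = f' x" if "x \<in> U" for x
    using frechet_derivative_at[OF assms(2)[OF that]] by simp
  then have "Ck_on k (\<lambda>x. frechet_derivative f (at x) b) U" if "b \<in> Basis" for b
    using Ck_on_cong[OF assms(1) _ assms(3)[OF that]] by auto
  then show ?thesis
    using assms(2) by (auto simp: Ck_on.simps(2) differentiable_def)
qed

lemma Ck_on_SucD:
  assumes "Ck_on (Suc k) f U"
  shows "\<And>x. x \<in> U \<Longrightarrow> (f has_derivative frechet_derivative f (at x)) (at x)"
    and "\<And>b. b \<in> Basis \<Longrightarrow> Ck_on k (\<lambda>x. frechet_derivative f (at x) b) U"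
  using assms by (auto simp: Ck_on.simps(2) frechet_derivative_works)

lemma Ck_on_Suc_imp: "Ck_on (Suc k) f U \<Longrightarrow> Ck_on k f U"
proof (induction k arbitrary: f)
  case 0
  then show ?case
    by (auto simp: Ck_on.simps(2) intro!: continuous_at_imp_continuous_on differentiable_imp_continuous_within)
next
  case (Suc k)
  then show ?case by (metis Ck_on.simps(2))
qed

lemma Ck_on_imp_continuous: "Ck_on k f U \<Longrightarrow> continuous_on U f"
  by (induction k) (use Ck_on_Suc_imp in auto)

lemma Ck_on_subset: "Ck_on k f U \<Longrightarrow> V \<subseteq> U \<Longrightarrow> Ck_on k f V"
proof (induction k arbitrary: f)
  case 0
  then show ?case using continuous_on_subset by auto
next
  case (Suc k)
  then show ?case by (metis Ck_on.simps(2) subsetD)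
qed

lemma Ck_on_const: "open U \<Longrightarrow> Ck_on k (\<lambda>x. c) U"
  by (induction k arbitrary: c) (auto intro: Ck_on_SucI[where f'="\<lambda>x h. 0"])

lemma Ck_on_linear: "open U \<Longrightarrow> bounded_linear f \<Longrightarrow> Ck_on k f U"
proof (cases k)
  case 0
  assume "bounded_linear f"
  then show ?thesis using 0 by (simp add: linear_continuous_on)
next
  case (Suc j)
  assume "open U" "bounded_linear f"
  then show ?thesis
    unfolding Suc by (intro Ck_on_SucI[where f'="\<lambda>x. f"] Ck_on_const bounded_linear_imp_has_derivative)
qed

lemma Ck_on_add:
  assumes "open U" shows "Ck_on k f U \<Longrightarrow> Ck_on k g U \<Longrightarrow> Ck_on k (\<lambda>x. f x + g x) U"
proof (induction k arbitrary: f g)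
  case 0
  then show ?case by (auto intro: continuous_on_add)
next
  case (Suc k)
  show ?case
    by (rule Ck_on_SucI[OF assms has_derivative_add[OF Ck_on_SucD(1)[OF Suc.prems(1)] Ck_on_SucD(1)[OF Suc.prems(2)]]])
      (auto intro!: Suc.IH Ck_on_SucD(2)[OF Suc.prems(1)] Ck_on_SucD(2)[OF Suc.prems(2)])
qed

lemma Ck_on_sum:
  assumes "open U" "\<And>i. i \<in> F \<Longrightarrow> Ck_on k (f i) U"
  shows "Ck_on k (\<lambda>x. \<Sum>i\<in>F. f i x) U"
  using assms(2) by (induction F rule: infinite_finite_induct) (auto intro: Ck_on_const Ck_on_add assms(1))

lemma (in bounded_bilinear) Ck_on_prod:
  assumes "open U" shows "Ck_on k f U \<Longrightarrow> Ck_on k g U \<Longrightarrow> Ck_on k (\<lambda>x. prod (f x) (g x)) U"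
proof (induction k arbitrary: f g)
  case 0
  then show ?case by (auto intro: continuous_on)
next
  case (Suc k)
  show ?case
    by (rule Ck_on_SucI[OF assms FDERIV[OF Ck_on_SucD(1)[OF Suc.prems(1)] Ck_on_SucD(1)[OF Suc.prems(2)]]])
     (auto intro!: Ck_on_add assms Suc.IH Ck_on_SucD(2)[OF Suc.prems(1)] Ck_on_SucD(2)[OF Suc.prems(2)]
          Ck_on_Suc_imp[OF Suc.prems(1)] Ck_on_Suc_imp[OF Suc.prems(2)])
qed

lemma Ck_on_linear_outer:
  assumes "open U" "bounded_linear h" shows "Ck_on k f U \<Longrightarrow> Ck_on k (\<lambda>x. h (f x)) U"
proof (induction k arbitrary: f)
  case 0
  then show ?case by (auto intro: bounded_linear.continuous_on assms)
next
  case (Suc k)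
  show ?case
    by (rule Ck_on_SucI[OF assms(1) bounded_linear.has_derivative[OF assms(2) Ck_on_SucD(1)[OF Suc.prems(1)]]])
     (auto intro!: Suc.IH Ck_on_SucD(2)[OF Suc.prems(1)])
qed

lemma linear_eq_sum_Basis:
  fixes f :: "'a::euclidean_space \<Rightarrow> 'b::real_normed_vector"
  assumes "linear f" shows "f v = (\<Sum>b\<in>Basis. (v \<bullet> b) *\<^sub>R f b)"
proof -
  have "f v = f (\<Sum>b\<in>Basis. (v \<bullet> b) *\<^sub>R b)"
    by (simp add: euclidean_representation)
  then show ?thesis
    by (simp add: linear_sum[OF assms] linear_scale[OF assms])
qed

lemma Ck_on_directional:
  assumes "open U" "Ck_on (Suc k) f U"
  shows "Ck_on k (\<lambda>x. frechet_derivative f (at x) v) U"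
proof (rule Ck_on_cong[OF assms(1)])
  show "Ck_on k (\<lambda>x. \<Sum>b\<in>Basis. (v \<bullet> b) *\<^sub>R frechet_derivative f (at x) b) U"
    by (rule Ck_on_sum[OF assms(1)], rule Ck_on_linear_outer[OF assms(1) bounded_linear_scaleR_right])
      (rule Ck_on_SucD(2)[OF assms(2)])
next
  fix x assume "x \<in> U"
  then have "linear (frechet_derivative f (at x))"
    using Ck_on_SucD(1)[OF assms(2)] has_derivative_linear by blast
  then show "(\<Sum>b\<in>Basis. (v \<bullet> b) *\<^sub>R frechet_derivative f (at x) b) = frechet_derivative f (at x) v"
    using linear_eq_sum_Basis[of "frechet_derivative f (at x)" v] by simp
qed

lemma Ck_on_linear_inner:
  assumes A: "bounded_linear A" and "open U" "open V" "A ` V \<subseteq> U"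
  shows "Ck_on k f U \<Longrightarrow> Ck_on k (\<lambda>x. f (A x)) V"
proof (induction k arbitrary: f)
  case 0
  then show ?case
    using assms by (auto intro!: continuous_on_compose2[OF _ linear_continuous_on[OF A]])
next
  case (Suc k)
  have "((\<lambda>x. f (A x)) has_derivative (\<lambda>h. frechet_derivative f (at (A x)) (A h))) (at x)" if "x \<in> V" for x
    using has_derivative_compose[OF bounded_linear_imp_has_derivative[OF A]] Ck_on_SucD(1)[OF Suc.prems(1)]
    that assms(4) by blast
  then show ?case
    by (rule Ck_on_SucI[OF assms(3)]) (auto intro!: Suc.IH Ck_on_directional assms Suc.prems(1))
qed

text \<open>The exponent has to vary in the induction, because differentiation lowers it by one.\<close>

lemma Ck_on_powr:
  fixes g :: "'a::euclidean_space \<Rightarrow> real"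
  assumes "open U" "\<And>x. x \<in> U \<Longrightarrow> g x > 0"
  shows "Ck_on k g U \<Longrightarrow> Ck_on k (\<lambda>x. g x powr a) U"
  using assms(2)
proof (induction k arbitrary: a)
  case 0
  have "g x \<noteq> 0" if "x \<in> U" for x
    using 0(2)[OF that] by simp
  with 0(1)  show ?case by (auto intro!: continuous_intros)
next
  case (Suc k)
  have "((\<lambda>x. g x powr a) has_derivative (\<lambda>h. (a * (g x powr (a - 1))) * frechet_derivative g (at x) h)) (at x)" if "x \<in> U" for x
  proof -
    have "((\<lambda>y. y powr a) has_real_derivative a * g x powr (a - 1)) (at (g x))"
      using Suc.prems(2)[OF that] by (rule has_real_derivative_powr)
    then show ?thesis
      using has_derivative_compose[OF Ck_on_SucD(1)[OF Suc.prems(1) that]]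
      by (simp add: has_field_derivative_def)
  qed
  then show ?case
  proof (rule Ck_on_SucI[OF assms(1)])
    fix b :: 'a assume b: "b \<in> Basis"
    have g: "Ck_on k g U"
      by (rule Ck_on_Suc_imp[OF Suc.prems(1)])
    have "Ck_on k (\<lambda>x. a * g x powr (a - 1)) U"
      using bounded_bilinear.Ck_on_prod[OF bounded_bilinear_mult assms(1) Ck_on_const[OF assms(1)] Suc.IH[OF g Suc.prems(2)]] .
    then show "Ck_on k (\<lambda>x. a * g x powr (a - 1) * frechet_derivative g (at x) b) U"
      using bounded_bilinear.Ck_on_prod[OF bounded_bilinear_mult assms(1) _ Ck_on_SucD(2)[OF Suc.prems(1) b]] by blast
  qed
qed

text \<open>The operator norm of the derivative is bounded by the sum of the partial derivatives, which is
  continuous; the mean value inequality turns this bound into a Lipschitz constant.\<close>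

lemma C1_on_lipschitz_on_compact_convex:
  fixes f :: "'a::euclidean_space \<Rightarrow> 'b::real_normed_vector"
  assumes "Ck_on (Suc 0) f U" "compact K" "convex K" "K \<subseteq> U"
  obtains C where "C-lipschitz_on K f"
proof -
  let ?D = "\<lambda>x. frechet_derivative f (at x)"
  have "continuous_on K (\<lambda>x. \<Sum>b\<in>Basis. norm (?D x b))"
    using Ck_on_SucD(2)[OF assms(1)] assms(4) by (auto intro!: continuous_intros intro: continuous_on_subset)
  then have "bounded ((\<lambda>x. \<Sum>b\<in>Basis. norm (?D x b)) ` K)"
    using assms(2) compact_continuous_image compact_imp_bounded by blast
  then obtain C where C: "0 < C" "\<And>x. x \<in> K \<Longrightarrow> (\<Sum>b\<in>Basis. norm (?D x b)) \<le> C"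
    unfolding bounded_pos by fastforce
  have d: "(f has_derivative ?D x) (at x within K)" if "x \<in> K" for x
    using Ck_on_SucD(1)[OF assms(1)] assms(4) that has_derivative_at_withinI by blast
  have "onorm (?D x) \<le> C" if "x \<in> K" for x
  proof (rule onorm_bound)
    fix h
    have "linear (?D x)"
      using d[OF that] has_derivative_linear by blast
    then have "?D x h = (\<Sum>b\<in>Basis. (h \<bullet> b) *\<^sub>R ?D x b)"
      by (rule linear_eq_sum_Basis)
    also have "norm \<dots> \<le> (\<Sum>b\<in>Basis. norm h * norm (?D x b))"
      by (intro sum_norm_le) (auto simp: Basis_le_norm mult_right_mono)
    also have "\<dots> = (\<Sum>b\<in>Basis. norm (?D x b)) * norm h"
      by (simp add: sum_distrib_left sum_distrib_right mult.commute)
    also have "\<dots> \<le> C * norm h"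
      using C(2)[OF that] by (simp add: mult_right_mono)
    finally show "norm (?D x h) \<le> C * norm h" .
  qed (use C in simp)
  then have "C-lipschitz_on K f"
    using differentiable_bound[OF assms(3) d] C(1) by (intro lipschitz_onI) (auto simp: dist_norm)
  then show ?thesis using that by blast
qed

lemma riesz_Basis:
  fixes f :: "'a::euclidean_space \<Rightarrow> real"
  assumes "linear f" shows "(\<Sum>b\<in>Basis. f b *\<^sub>R b) \<bullet> d = f d"
  using linear_eq_sum_Basis[OF assms, of d] by (simp add: inner_sum_left inner_sum_right inner_commute mult.commute)

text \<open>Used to regard a derivative as a smooth function of the base point and the direction together,
  as the right-hand side of the geodesic equation requires.\<close>

lemma Ck_on_evaluate:
  fixes F :: "'a::euclidean_space \<Rightarrow> 'a \<Rightarrow> 'b::real_normed_vector"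
  assumes V: "open V" and lin: "\<And>x. x \<in> V \<Longrightarrow> linear (F x)" and F: "\<And>b. Ck_on k (\<lambda>x. F x b) V"
  shows "Ck_on k (\<lambda>z. F (fst z) (snd z)) (V \<times> UNIV)"
proof -
  have op: "open (V \<times> (UNIV :: 'a set))"
    using V by (intro open_Times) auto
  show ?thesis
  proof (rule Ck_on_cong[OF op])
    show "(\<Sum>b\<in>Basis. (snd z \<bullet> b) *\<^sub>R F (fst z) b) = F (fst z) (snd z)" if "z \<in> V \<times> UNIV" for z
      by (rule linear_eq_sum_Basis[OF lin, symmetric]) (use that in \<open>simp add: mem_Times_iff\<close>)
    have "Ck_on k (\<lambda>z. (snd z \<bullet> b) *\<^sub>R F (fst z) b) (V \<times> UNIV)" for b
    proof (rule bounded_bilinear.Ck_on_prod[OF bounded_bilinear_scaleR op])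
      show "Ck_on k (\<lambda>z. snd z \<bullet> b) (V \<times> UNIV)"
        by (rule Ck_on_linear[OF op]) (rule bounded_linear_intros)+
      show "Ck_on k (\<lambda>z. F (fst z) b) (V \<times> (UNIV :: 'a set))"
        by (rule Ck_on_linear_inner[where f="\<lambda>x. F x b", OF bounded_linear_fst V op _ F]) auto
    qed
    then show "Ck_on k (\<lambda>z. \<Sum>b\<in>Basis. (snd z \<bullet> b) *\<^sub>R F (fst z) b) (V \<times> UNIV)"
      by (rule Ck_on_sum[OF op])
  qed
qed

section \<open>Symmetry of second derivatives\<close>

text \<open>The second difference of \<open>f\<close> over a small parallelogram with sides \<open>h v\<close> and \<open>h w\<close> is
  symmetric in \<open>v\<close> and \<open>w\<close>. By the mean value theorem, applied twice to a component, it is \<open>h\<^sup>2\<close>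
  times a second derivative at a nearby point, in either order; continuity at \<open>x\<close> does the rest.\<close>

lemma second_derivative_symmetric:
  fixes f :: "'a::euclidean_space \<Rightarrow> 'b::euclidean_space"
  assumes U: "open U" and f: "Ck_on (Suc (Suc 0)) f U" and x: "x \<in> U"
  shows "frechet_derivative (\<lambda>y. frechet_derivative f (at y) v) (at x) w =
         frechet_derivative (\<lambda>y. frechet_derivative f (at y) w) (at x) v"
proof -
  define D2 where "D2 v w y = frechet_derivative (\<lambda>y. frechet_derivative f (at y) v) (at y) w" for v w y
  have cont: "continuous_on U (D2 v w)" for v w
    unfolding D2_def [abs_def] using Ck_on_directional[OF U Ck_on_directional[OF U f]] by simp
  have 1: "(f has_derivative frechet_derivative f (at y)) (at y)" if "y \<in> U" for y
    using Ck_on_SucD(1)[OF f that] .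
  have 2: "((\<lambda>y. frechet_derivative f (at y) v) has_derivative (\<lambda>w. D2 v w y)) (at y)" if "y \<in> U" for y v
    unfolding D2_def using Ck_on_SucD(1)[OF Ck_on_directional[OF U f] that] .
  have mvt: "\<exists>s t. 0 < s \<and> s < h \<and> 0 < t \<and> t < h \<and>
      (f (x + h *\<^sub>R v + h *\<^sub>R w) - f (x + h *\<^sub>R v) - f (x + h *\<^sub>R w) + f x) \<bullet> e
        = h\<^sup>2 * (D2 v w (x + s *\<^sub>R v + t *\<^sub>R w) \<bullet> e)"
    if h: "h > 0" and sub: "\<And>s t. 0 \<le> s \<Longrightarrow> s \<le> h \<Longrightarrow> 0 \<le> t \<Longrightarrow> t \<le> h \<Longrightarrow> x + s *\<^sub>R v + t *\<^sub>R w \<in> U"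
    for h v w e
  proof -
    let ?\<phi> = "\<lambda>s. (f (x + s *\<^sub>R v + h *\<^sub>R w) - f (x + s *\<^sub>R v)) \<bullet> e"
    let ?D = "\<lambda>y. frechet_derivative f (at y) v"
    have lin: "frechet_derivative f (at y) (s *\<^sub>R v) = s *\<^sub>R ?D y" if "y \<in> U" for y s
      using has_derivative_linear[OF 1[OF that]] linear_scale by blast
    have d\<phi>: "(?\<phi> has_real_derivative (?D (x + s *\<^sub>R v + h *\<^sub>R w) - ?D (x + s *\<^sub>R v)) \<bullet> e) (at s)"
      if "0 \<le> s" "s \<le> h" for s
    proof -
      have a: "x + s *\<^sub>R v + h *\<^sub>R w \<in> U" "x + s *\<^sub>R v \<in> U"
        using sub[OF that, of h] sub[OF that, of 0] h by auto
      have "((\<lambda>s. f (x + s *\<^sub>R v + h *\<^sub>R w)) has_derivative (\<lambda>k. frechet_derivative f (at (x + s *\<^sub>R v + h *\<^sub>R w)) (k *\<^sub>R v))) (at s)"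
           "((\<lambda>s. f (x + s *\<^sub>R v)) has_derivative (\<lambda>k. frechet_derivative f (at (x + s *\<^sub>R v)) (k *\<^sub>R v))) (at s)"
        by (rule has_derivative_compose[of "\<lambda>s. x + s *\<^sub>R v + h *\<^sub>R w" "\<lambda>k. k *\<^sub>R v" s UNIV f, OF _ 1[OF a(1)]]
            has_derivative_compose[of "\<lambda>s. x + s *\<^sub>R v" "\<lambda>k. k *\<^sub>R v" s UNIV f, OF _ 1[OF a(2)]],
            auto intro!: derivative_eq_intros)+
      from has_derivative_inner_left[OF has_derivative_diff[OF this], of e] show ?thesis
        unfolding has_field_derivative_def
        by (rule has_derivative_eq_rhs) (use lin a in \<open>auto simp: fun_eq_iff algebra_simps inner_diff_left\<close>)
    qed
    then obtain s where s: "0 < s" "s < h" and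
      "?\<phi> h - ?\<phi> 0 = (h - 0) * ((?D (x + s *\<^sub>R v + h *\<^sub>R w) - ?D (x + s *\<^sub>R v)) \<bullet> e)"
      using MVT2[OF h d\<phi>] by blast
    then have \<phi>: "?\<phi> h - ?\<phi> 0 = h * ((?D (x + s *\<^sub>R v + h *\<^sub>R w) - ?D (x + s *\<^sub>R v)) \<bullet> e)"
      by simp
    let ?\<psi> = "\<lambda>t. ?D (x + s *\<^sub>R v + t *\<^sub>R w) \<bullet> e"
    have d\<psi>: "(?\<psi> has_real_derivative D2 v w (x + s *\<^sub>R v + t *\<^sub>R w) \<bullet> e) (at t)"
      if "0 \<le> t" "t \<le> h" for t
    proof -
      have a: "x + s *\<^sub>R v + t *\<^sub>R w \<in> U"
        using sub s that by auto
      have lin: "D2 v (k *\<^sub>R w) (x + s *\<^sub>R v + t *\<^sub>R w) = k *\<^sub>R D2 v w (x + s *\<^sub>R v + t *\<^sub>R w)" for k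
        using has_derivative_linear[OF 2[OF a]] linear_scale by blast
      have "((\<lambda>t. ?D (x + s *\<^sub>R v + t *\<^sub>R w)) has_derivative (\<lambda>k. D2 v (k *\<^sub>R w) (x + s *\<^sub>R v + t *\<^sub>R w))) (at t)"
        by (rule has_derivative_compose[of "\<lambda>t. x + s *\<^sub>R v + t *\<^sub>R w" "\<lambda>k. k *\<^sub>R w" t UNIV ?D, OF _ 2[OF a]])
          (auto intro!: derivative_eq_intros)
      from has_derivative_inner_left[OF this, of e] show ?thesis
        unfolding has_field_derivative_def lin by (simp add: mult_commute_abs)
    qed
    then obtain t where t: "0 < t" "t < h" and
      "?\<psi> h - ?\<psi> 0 = (h - 0) * (D2 v w (x + s *\<^sub>R v + t *\<^sub>R w) \<bullet> e)"
      using MVT2[OF h d\<psi>] by blast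
    with \<phi> have "?\<phi> h - ?\<phi> 0 = h * (h * (D2 v w (x + s *\<^sub>R v + t *\<^sub>R w) \<bullet> e))"
      by (simp add: inner_diff_left)
    with s t show ?thesis
      by (intro exI[of _ s] exI[of _ t]) (simp add: power2_eq_square algebra_simps)
  qed
  have "D2 v w x \<bullet> e = D2 w v x \<bullet> e" for e
  proof -
    have "\<bar>D2 v w x \<bullet> e - D2 w v x \<bullet> e\<bar> \<le> 2 * \<epsilon>" if "\<epsilon> > 0" for \<epsilon>
    proof -
      have ev: "\<forall>\<^sub>F y in nhds x. dist (D2 v w y \<bullet> e) (D2 v w x \<bullet> e) < \<epsilon>" for v w
      proof -
        have "isCont (\<lambda>y. D2 v w y \<bullet> e) x"
          using cont U x by (auto simp: continuous_on_eq_continuous_at intro!: continuous_intros)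
        then show ?thesis
          using that by (simp add: isCont_def tendsto_iff eventually_nhds_conv_at)
      qed
      have "\<forall>\<^sub>F y in nhds x. y \<in> U \<and> dist (D2 v w y \<bullet> e) (D2 v w x \<bullet> e) < \<epsilon> \<and> dist (D2 w v y \<bullet> e) (D2 w v x \<bullet> e) < \<epsilon>"
        using ev[of v w] ev[of w v] eventually_nhds_in_open[OF U x] by eventually_elim auto
      then obtain d where d: "d > 0" and
        near: "\<And>y. dist y x < d \<Longrightarrow> y \<in> U \<and> dist (D2 v w y \<bullet> e) (D2 v w x \<bullet> e) < \<epsilon> \<and> dist (D2 w v y \<bullet> e) (D2 w v x \<bullet> e) < \<epsilon>"
        by (auto simp: eventually_nhds_metric)
      define h where "h = d / (norm v + norm w + 1)"
      have nn: "norm v + norm w + 1 > 0"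
        by (smt (verit) norm_ge_zero)
      then have h: "h > 0"
        using d by (simp add: h_def)
      have close: "dist (x + s *\<^sub>R v + t *\<^sub>R w) x < d" if "0 \<le> s" "s \<le> h" "0 \<le> t" "t \<le> h" for s t
      proof -
        have "dist (x + s *\<^sub>R v + t *\<^sub>R w) x \<le> norm (s *\<^sub>R v) + norm (t *\<^sub>R w)"
          by (simp add: dist_norm add.assoc norm_triangle_ineq del: norm_scaleR)
        also have "\<dots> \<le> h * norm v + h * norm w"
          using that by (simp add: add_mono mult_right_mono)
        also have "\<dots> < h * (norm v + norm w + 1)"
          using h by (simp add: algebra_simps)
        also have "\<dots> = d"
          using nn by (simp add: h_def)
        finally show ?thesis .
      qed
      obtain s t where st: "0 < s" "s < h" "0 < t" "t < h" and
        1: "(f (x + h *\<^sub>R v + h *\<^sub>R w) - f (x + h *\<^sub>R v) - f (x + h *\<^sub>R w) + f x) \<bullet> e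
          = h\<^sup>2 * (D2 v w (x + s *\<^sub>R v + t *\<^sub>R w) \<bullet> e)"
        using mvt[OF h, of v w e] close near by blast
      have close': "dist (x + s *\<^sub>R w + t *\<^sub>R v) x < d" if "0 \<le> s" "s \<le> h" "0 \<le> t" "t \<le> h" for s t
        using close[of t s] that by (simp add: algebra_simps)
      obtain s' t' where st': "0 < s'" "s' < h" "0 < t'" "t' < h" and
        2: "(f (x + h *\<^sub>R w + h *\<^sub>R v) - f (x + h *\<^sub>R w) - f (x + h *\<^sub>R v) + f x) \<bullet> e
          = h\<^sup>2 * (D2 w v (x + s' *\<^sub>R w + t' *\<^sub>R v) \<bullet> e)"
        using mvt[OF h, of w v e] close' near by blast
      have "h\<^sup>2 * (D2 v w (x + s *\<^sub>R v + t *\<^sub>R w) \<bullet> e) = h\<^sup>2 * (D2 w v (x + s' *\<^sub>R w + t' *\<^sub>R v) \<bullet> e)"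
        unfolding 1[symmetric] 2[symmetric] by (simp add: algebra_simps)
      then have "D2 v w (x + s *\<^sub>R v + t *\<^sub>R w) \<bullet> e = D2 w v (x + s' *\<^sub>R w + t' *\<^sub>R v) \<bullet> e"
        using h by simp
      moreover have "dist (D2 v w (x + s *\<^sub>R v + t *\<^sub>R w) \<bullet> e) (D2 v w x \<bullet> e) < \<epsilon>"
        using near[OF close] st by auto
      moreover have "dist (D2 w v (x + s' *\<^sub>R w + t' *\<^sub>R v) \<bullet> e) (D2 w v x \<bullet> e) < \<epsilon>"
        using near[OF close'] st' by auto
      ultimately show ?thesis
        unfolding dist_real_def by linarith
    qed
    then show ?thesis
      by (metis (no_types, lifting) abs_le_zero_iff dual_order.refl eq_iff_diff_eq_0 field_le_epsilon
          add_0 field_sum_of_halves half_gt_zero_iff mult_2)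
  qed
  then show ?thesis
    unfolding D2_def by (metis vector_eq_rdot)
qed

section \<open>Differential equations and bilinear forms on a subspace\<close>

text \<open>The function \<open>\<bar>y\<bar>\<^sup>2 exp (- 2 C t)\<close> is nonincreasing, nonnegative, and zero at \<open>0\<close>.\<close>

lemma gronwall_zero:
  fixes y :: "real \<Rightarrow> 'a::real_inner"
  assumes der: "\<And>t. t \<in> {0..1} \<Longrightarrow> (y has_vector_derivative y' t) (at t within {0..1})"
    and bound: "\<And>t. t \<in> {0..1} \<Longrightarrow> norm (y' t) \<le> C * norm (y t)"
    and "y 0 = 0"
  shows "y 1 = 0"
proof -
  let ?\<phi> = "\<lambda>t. (y t \<bullet> y t) * exp (- (2 * C * t))"
  have "continuous_on {0..1} y"
    using der has_vector_derivative_continuous continuous_on_eq_continuous_within by blast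
  then have cont: "continuous_on {0..1} ?\<phi>"
    by (intro continuous_intros)
  have "?\<phi> 1 \<le> ?\<phi> 0"
  proof (rule DERIV_nonpos_imp_decreasing_open[OF _ _ cont])
    fix t :: real assume t: "0 < t" "t < 1"
    have "(y has_vector_derivative y' t) (at t)"
      using der[of t] t by (simp add: at_within_Icc_at)
    then have "(y has_derivative (\<lambda>h. h *\<^sub>R y' t)) (at t)"
      by (simp add: has_vector_derivative_def)
    from has_derivative_inner[OF this this]
    have "((\<lambda>t. y t \<bullet> y t) has_real_derivative 2 * (y t \<bullet> y' t)) (at t)"
      unfolding has_field_derivative_def
      by (rule has_derivative_eq_rhs) (auto simp: inner_commute)
    then have D: "(?\<phi> has_real_derivative 2 * (y t \<bullet> y' t - C * (y t \<bullet> y t)) * exp (- (2 * C * t))) (at t)"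
      by (auto intro!: derivative_eq_intros simp: algebra_simps)
    have "y t \<bullet> y' t \<le> norm (y t) * norm (y' t)"
      by (rule norm_cauchy_schwarz)
    also have "\<dots> \<le> norm (y t) * (C * norm (y t))"
      using bound[of t] t by (intro mult_left_mono) auto
    also have "\<dots> = C * (y t \<bullet> y t)"
      by (simp add: dot_square_norm power2_eq_square)
    finally have "2 * (y t \<bullet> y' t - C * (y t \<bullet> y t)) * exp (- (2 * C * t)) \<le> 0"
      by (simp add: mult_nonpos_nonneg)
    with D show "\<exists>z. (?\<phi> has_real_derivative z) (at t) \<and> z \<le> 0"
      by blast
  qed simp
  then have "y 1 \<bullet> y 1 \<le> 0"
    using \<open>y 0 = 0\<close> by (simp add: mult_le_0_iff)
  then show ?thesis
    by (metis inner_gt_zero_iff not_less)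
qed

lemma in_subspace_if_orthogonal:
  fixes E :: "'a::euclidean_space set"
  assumes "subspace E" "\<And>n. (\<And>e. e \<in> E \<Longrightarrow> n \<bullet> e = 0) \<Longrightarrow> n \<bullet> v = 0"
  shows "v \<in> E"
proof -
  obtain y z where yz: "y \<in> span E" "\<And>w. w \<in> span E \<Longrightarrow> orthogonal z w" "v = y + z"
    using orthogonal_subspace_decomp_exists[of E v] by metis
  have y: "y \<in> E"
    using yz(1) assms(1) by (metis span_eq_iff)
  have "z \<bullet> v = 0"
    using assms(2) yz(2) span_base unfolding orthogonal_def by blast
  moreover have "z \<bullet> y = 0"
    using yz(1,2) unfolding orthogonal_def by blast
  ultimately show ?thesis
    using yz(3) y by (simp add: inner_add_right)
qed

lemma integral_in_subspace:
  fixes f :: "real \<Rightarrow> 'a::euclidean_space"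
  assumes "subspace E" "f integrable_on S" "\<And>s. s \<in> S \<Longrightarrow> f s \<in> E"
  shows "integral S f \<in> E"
proof (rule in_subspace_if_orthogonal[OF assms(1)])
  fix n assume "\<And>e. e \<in> E \<Longrightarrow> n \<bullet> e = 0"
  then have "integral S (\<lambda>s. n \<bullet> f s) = 0"
    using assms(3) by (metis (no_types, lifting) integral_0 integral_cong)
  then show "n \<bullet> integral S f = 0"
    using integral_linear[OF assms(2) bounded_linear_inner_right, of n] by (simp add: o_def)
qed

text \<open>Picard's contraction argument in the space of bounded continuous functions. The field is made
  globally Lipschitz by composing it with the nearest-point projection to \<open>E \<inter> cball z0 \<epsilon>\<close>; for a
  short time the fixed point does not leave this set, so there it solves the original equation. The
  equation is posed on a subspace \<open>E\<close> because a submanifold is parametrized by a subspace.\<close>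

lemma picard_lindelof:
  fixes f :: "'a::euclidean_space \<Rightarrow> 'a"
  assumes E: "subspace E" and z0: "z0 \<in> E" and \<epsilon>: "\<epsilon> > 0"
    and lip: "L-lipschitz_on (E \<inter> cball z0 \<epsilon>) f"
    and fE: "\<And>z. z \<in> E \<inter> cball z0 \<epsilon> \<Longrightarrow> f z \<in> E"
  obtains \<delta> z where "\<delta> > 0" "z 0 = z0"
    "\<And>t. t \<in> {0..\<delta>} \<Longrightarrow> z t \<in> E \<inter> cball z0 \<epsilon>"
    "\<And>t. t \<in> {0..\<delta>} \<Longrightarrow> (z has_vector_derivative f (z t)) (at t within {0..\<delta>})"
proof -
  let ?K = "E \<inter> cball z0 \<epsilon>"
  have K: "convex ?K" "closed ?K" "?K \<noteq> {}" and z0K: "z0 \<in> ?K"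
    using E z0 \<epsilon> by (auto intro: convex_Int subspace_imp_convex closed_Int closed_subspace)
  define g where "g z = f (closest_point ?K z)" for z
  have L: "L \<ge> 0"
    using lip by (rule lipschitz_on_nonneg)
  have inK: "closest_point ?K z \<in> ?K" for z
    by (rule closest_point_in_set[OF K(2,3)])
  have g_lip: "norm (g y - g z) \<le> L * norm (y - z)" for y z
  proof -
    have "dist (g y) (g z) \<le> L * dist (closest_point ?K y) (closest_point ?K z)"
      unfolding g_def using lipschitz_onD[OF lip inK inK] .
    also have "\<dots> \<le> L * dist y z"
      using closest_point_lipschitz[OF K] L by (intro mult_left_mono)
    finally show ?thesis by (simp add: dist_norm)
  qed
  define b where "b = norm (f z0) + L * \<epsilon> + 1"
  have b: "b > 0"
    using L \<epsilon> by (simp add: b_def add_nonneg_pos)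
  have g_bound: "norm (g z) \<le> b" for z
  proof -
    have "dist (g z) (f z0) \<le> L * dist (closest_point ?K z) z0"
      unfolding g_def using lipschitz_onD[OF lip inK z0K] .
    also have "\<dots> \<le> L * \<epsilon>"
      using inK[of z] L by (intro mult_left_mono) (auto simp: dist_commute)
    finally show ?thesis
      unfolding b_def dist_norm by (smt (verit) norm_triangle_sub)
  qed
  have g_cont: "continuous_on X g" for X
    by (rule lipschitz_on_continuous_on[of L]) (use g_lip L in \<open>auto intro!: lipschitz_onI simp: dist_norm\<close>)
  have gE: "g z \<in> E" for z
    unfolding g_def using fE[OF inK] .
  define \<delta> where "\<delta> = min (\<epsilon> / b) (1 / (2 * (L + 1)))"
  have \<delta>: "\<delta> > 0" "\<delta> * b \<le> \<epsilon>" "\<delta> * L \<le> 1 / 2"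
  proof -
    show "\<delta> > 0"
      using b \<epsilon> L by (auto simp: \<delta>_def)
    have "\<delta> \<le> \<epsilon> / b" "\<delta> \<le> 1 / (2 * (L + 1))"
      by (auto simp: \<delta>_def)
    then have "\<delta> * b \<le> \<epsilon>" "\<delta> * (2 * (L + 1)) \<le> 1"
      using b L by (auto simp: field_simps)
    with \<open>\<delta> > 0\<close> show "\<delta> * b \<le> \<epsilon>" "\<delta> * L \<le> 1 / 2"
      by (auto simp: algebra_simps)
  qed
  \<comment> \<open>Clamping the time to \<open>{0..\<delta>}\<close> makes the Picard iterates bounded functions on all of \<open>real\<close>.\<close>
  define c where "c t = max 0 (min \<delta> t)" for t
  have c: "0 \<le> c t" "c t \<le> \<delta>" for t
    using \<delta>(1) by (auto simp: c_def)
  define T where "T \<phi> t = z0 + integral {0..c t} (\<lambda>s. g (apply_bcontfun \<phi> s))" for \<phi> t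
  have int: "(\<lambda>s. g (apply_bcontfun \<phi> s)) integrable_on {0..u}" for u and \<phi> :: "real \<Rightarrow>\<^sub>C 'a"
    by (intro integrable_continuous_interval continuous_on_compose2[OF g_cont] continuous_on_apply_bcontfun) auto
  have int_le: "norm (integral {0..u} (\<lambda>s. g (apply_bcontfun \<phi> s))) \<le> b * u" if "0 \<le> u" for u and \<phi> :: "real \<Rightarrow>\<^sub>C 'a"
    using integral_bound[OF that, of "\<lambda>s. g (apply_bcontfun \<phi> s)" b] g_bound
    by (auto intro!: continuous_on_compose2[OF g_cont])
  have T: "T \<phi> \<in> bcontfun" for \<phi>
  proof (rule bcontfun_normI)
    have int_cont: "continuous_on {0..\<delta>} (\<lambda>u. integral {0..u} (\<lambda>s. g (apply_bcontfun \<phi> s)))"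
      by (rule indefinite_integral_continuous_1[OF int])
    have "continuous_on UNIV c"
      unfolding c_def [abs_def] by (intro continuous_intros)
    then have "continuous_on UNIV (\<lambda>t. integral {0..c t} (\<lambda>s. g (apply_bcontfun \<phi> s)))"
      by (rule continuous_on_compose2[OF int_cont]) (use c in auto)
    then show "continuous_on UNIV (T \<phi>)"
      unfolding T_def [abs_def] by (intro continuous_on_add continuous_on_const)
    fix t
    have "norm (integral {0..c t} (\<lambda>s. g (apply_bcontfun \<phi> s))) \<le> b * \<delta>"
      using int_le[OF c(1)] c(2) b by (meson dual_order.trans mult_le_cancel_left_pos)
    then show "norm (T \<phi> t) \<le> norm z0 + b * \<delta>"
      unfolding T_def by (smt (verit) norm_triangle_ineq)
  qed
  have "\<exists>!\<phi>. Bcontfun (T \<phi>) = \<phi>"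
  proof (rule banach_fix_type[of "1/2"], safe)
    fix \<phi> \<psi> :: "real \<Rightarrow>\<^sub>C 'a"
    show "dist (Bcontfun (T \<phi>)) (Bcontfun (T \<psi>)) \<le> 1 / 2 * dist \<phi> \<psi>"
    proof (rule dist_bound)
      fix t
      have "T \<phi> t - T \<psi> t = integral {0..c t} (\<lambda>s. g (apply_bcontfun \<phi> s) - g (apply_bcontfun \<psi> s))"
        unfolding T_def by (simp add: integral_diff int)
      also have "norm \<dots> \<le> (L * dist \<phi> \<psi>) * (c t - 0)"
      proof (rule integral_bound[OF c(1)])
        show "norm (g (apply_bcontfun \<phi> s) - g (apply_bcontfun \<psi> s)) \<le> L * dist \<phi> \<psi>" for s
          using g_lip[of "apply_bcontfun \<phi> s" "apply_bcontfun \<psi> s"] dist_bounded[of \<phi> s \<psi>] L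
          by (metis dist_norm dual_order.trans mult_left_mono)
      qed (intro continuous_intros continuous_on_compose2[OF g_cont]; auto)
      also have "\<dots> \<le> (L * dist \<phi> \<psi>) * \<delta>"
        using c[of t] L by (intro mult_left_mono) auto
      also have "\<dots> = (\<delta> * L) * dist \<phi> \<psi>"
        by simp
      also have "\<dots> \<le> 1 / 2 * dist \<phi> \<psi>"
        using \<delta>(3) by (intro mult_right_mono) auto
      finally show "dist (apply_bcontfun (Bcontfun (T \<phi>)) t) (apply_bcontfun (Bcontfun (T \<psi>)) t) \<le> 1 / 2 * dist \<phi> \<psi>"
        by (simp add: Bcontfun_inverse T dist_norm)
    qed
  qed auto
  then obtain \<phi> where "Bcontfun (T \<phi>) = \<phi>" by blast
  then have fp: "apply_bcontfun \<phi> t = T \<phi> t" for t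
    by (metis Bcontfun_inverse T)
  define z where "z = apply_bcontfun \<phi>"
  have z: "z t = z0 + integral {0..t} (\<lambda>s. g (z s))" if "t \<in> {0..\<delta>}" for t
  proof -
    have "c t = t"
      using that by (simp add: c_def)
    then show ?thesis
      using fp[of t] by (simp add: z_def T_def)
  qed
  have zK: "z t \<in> ?K" if "t \<in> {0..\<delta>}" for t
  proof -
    have "integral {0..t} (\<lambda>s. g (z s)) \<in> E"
      unfolding z_def by (intro integral_in_subspace E int gE)
    then have "z t \<in> E"
      using z[OF that] E z0 by (simp add: subspace_add)
    moreover have "norm (integral {0..t} (\<lambda>s. g (z s))) \<le> b * t"
      unfolding z_def using int_le that by simp
    then have "norm (integral {0..t} (\<lambda>s. g (z s))) \<le> \<epsilon>"
      using \<delta>(2) that b by (smt (verit) atLeastAtMost_iff mult.commute mult_left_mono)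
    then have "dist z0 (z t) \<le> \<epsilon>"
      using z[OF that] by (simp add: dist_norm)
    ultimately show ?thesis by simp
  qed
  show ?thesis
  proof
    show "\<delta> > 0" by fact
    show "z 0 = z0" using z[of 0] \<delta>(1) by simp
    fix t assume t: "t \<in> {0..\<delta>}"
    show "z t \<in> ?K" by (rule zK[OF t])
    have "((\<lambda>u. integral {0..u} (\<lambda>s. g (z s))) has_vector_derivative g (z t)) (at t within {0..\<delta>})"
      unfolding z_def by (rule integral_has_vector_derivative[OF _ t])
        (intro continuous_on_compose2[OF g_cont] continuous_on_apply_bcontfun; auto)
    then have "((\<lambda>u. z0 + integral {0..u} (\<lambda>s. g (z s))) has_vector_derivative g (z t)) (at t within {0..\<delta>})"
      by (auto intro!: derivative_eq_intros)
    then have "(z has_vector_derivative g (z t)) (at t within {0..\<delta>})"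
      by (rule has_vector_derivative_transform[OF t, rotated]) (rule z)
    moreover have "g (z t) = f (z t)"
      unfolding g_def using closest_point_self[OF zK[OF t]] by simp
    ultimately show "(z has_vector_derivative f (z t)) (at t within {0..\<delta>})"
      by simp
  qed
qed

text \<open>An orthonormal basis of \<open>E\<close> represents linear functionals on \<open>E\<close> by vectors in \<open>E\<close> that
  depend continuously on the values of the functional at finitely many vectors.\<close>

lemma subspace_riesz:
  fixes E :: "'a::euclidean_space set"
  assumes "subspace E"
  obtains S where "finite S" "S \<subseteq> E"
    "\<And>(f :: 'a \<Rightarrow> real) u. linear f \<Longrightarrow> u \<in> E \<Longrightarrow> (\<Sum>b\<in>S. f b *\<^sub>R b) \<bullet> u = f u"
proof -
  obtain S where S: "S \<subseteq> E" "pairwise orthogonal S" "\<And>x. x \<in> S \<Longrightarrow> norm x = 1" "independent S" "span S = E"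
    using orthonormal_basis_subspace[OF assms] by metis
  have fin: "finite S"
    using S(4) independent_imp_finite by blast
  have "(\<Sum>b\<in>S. f b *\<^sub>R b) \<bullet> u = f u" if f: "linear f" and u: "u \<in> E" for f :: "'a \<Rightarrow> real" and u
  proof -
    have "(\<Sum>b\<in>S. f b *\<^sub>R b) \<bullet> c = f c" if "c \<in> S" for c
    proof -
      have "(\<Sum>b\<in>S. f b *\<^sub>R b) \<bullet> c = (\<Sum>b\<in>S. if b = c then f c else 0)"
        unfolding inner_sum_left
      proof (rule sum.cong)
        fix b assume "b \<in> S"
        then show "f b *\<^sub>R b \<bullet> c = (if b = c then f c else 0)"
          using S(2,3) that by (auto simp: pairwise_def orthogonal_def dot_square_norm)
      qed simp
      then show ?thesis using fin that by simp
    qed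
    then show ?thesis
      using linear_eq_on_span[OF bounded_linear.linear[OF bounded_linear_inner_right] f] u S(5) by blast
  qed
  with fin S(1) show ?thesis using that by blast
qed

text \<open>The map that sends \<open>u\<close> to the representing vector of \<open>G u\<close> is injective on \<open>E\<close>, by
  definiteness, and therefore maps \<open>E\<close> onto \<open>E\<close>.\<close>

lemma positive_definite_represents:
  fixes G :: "'a::euclidean_space \<Rightarrow> 'a \<Rightarrow> real"
  assumes E: "subspace E" and G: "bounded_bilinear G" and pos: "\<And>u. u \<in> E \<Longrightarrow> u \<noteq> 0 \<Longrightarrow> G u u > 0"
    and l: "linear l"
  shows "\<exists>u\<in>E. \<forall>e\<in>E. G u e = l e"
proof -
  obtain S where S: "finite S" "S \<subseteq> E"
    and riesz: "\<And>(f :: 'a \<Rightarrow> real) u. linear f \<Longrightarrow> u \<in> E \<Longrightarrow> (\<Sum>b\<in>S. f b *\<^sub>R b) \<bullet> u = f u"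
    using subspace_riesz[OF E] by metis
  define A where "A u = (\<Sum>b\<in>S. G u b *\<^sub>R b)" for u
  have A: "A u \<bullet> e = G u e" if "e \<in> E" for u e
    unfolding A_def using riesz[OF bounded_linear.linear[OF bounded_bilinear.bounded_linear_right[OF G]] that] .
  have in_E: "(\<Sum>b\<in>S. f b *\<^sub>R b) \<in> E" for f
    using S(2) E by (auto intro!: subspace_sum subspace_scale)
  have lin: "linear A"
    unfolding A_def [abs_def] using bounded_bilinear.add_left[OF G] bounded_bilinear.scaleR_left[OF G]
    by (intro linearI) (auto simp: algebra_simps sum.distrib scaleR_sum_right)
  have "inj_on A E"
  proof (subst linear_inj_on_iff_eq_0[OF lin E], safe)
    fix u assume u: "u \<in> E" "A u = 0"
    then have "G u u = 0" using A[OF u(1), of u] by simp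
    then show "u = 0" using pos[OF u(1)] by fastforce
  qed
  then have "dim (A ` E) = dim E"
    using lin E by (metis dim_image_eq span_eq_iff)
  moreover have "A ` E \<subseteq> E"
    using in_E unfolding A_def by blast
  ultimately have "A ` E = E"
    using subspace_dim_equal[OF linear_subspace_image[OF lin E] E] by auto
  then obtain u where "u \<in> E" "A u = (\<Sum>b\<in>S. l b *\<^sub>R b)"
    using in_E[of l] by (metis imageE)
  then show ?thesis
    using A riesz[OF l] by metis
qed

section \<open>Space forms as quadrics\<close>

lemma parameter_interval_nontrivial:
  assumes "parameter_interval J" "s \<in> J"
  shows "at s within J \<noteq> bot"
proof -
  have "connected J" "J \<noteq> {x}" for x
    using assms(1) by (auto simp: parameter_interval_def is_interval_connected)
  then have "s islimpt J"
    using connected_imp_perfect assms(2) by blast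
  then show ?thesis
    by (simp add: trivial_limit_within)
qed

text \<open>Parameter intervals may contain end points; the derivative is still unique there. Below, this
  lemma differentiates the orthogonality relations along a curve.\<close>

lemma vector_derivative_of_constant:
  assumes "parameter_interval J" "s \<in> J" "(f has_vector_derivative D) (at s within J)"
    and "\<And>s. s \<in> J \<Longrightarrow> f s = c"
  shows "D = 0"
proof -
  have "((\<lambda>_. c) has_vector_derivative D) (at s within J)"
    using has_vector_derivative_transform[OF assms(2) _ assms(3)] assms(4) by simp
  then show ?thesis
    using vector_derivative_unique_within[OF parameter_interval_nontrivial[OF assms(1,2)]]
      has_vector_derivative_const by blast
qed

text \<open>The sphere is the case \<open>\<beta> = r\<^sup>2\<close>, and hyperbolic space is the case \<open>\<beta> = - r\<^sup>2\<close> with the half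
  space of positive time-like coordinate as \<open>\<Omega>\<close>.\<close>

locale space_form =
  fixes B :: "'a::euclidean_space \<Rightarrow> 'a \<Rightarrow> real" and M \<Omega> :: "'a set" and \<beta> :: real
  assumes bilinear: "bounded_bilinear B"
    and sym: "B x y = B y x"
    and open_\<Omega>: "open \<Omega>"
    and M_eq: "M = {q \<in> \<Omega>. B q q = \<beta>}"
    and \<beta>_nonzero: "\<beta> \<noteq> 0"
    and positive: "q \<in> M \<Longrightarrow> B v q = 0 \<Longrightarrow> v \<noteq> 0 \<Longrightarrow> B v v > 0"
begin

sublocale bounded_bilinear B by (rule bilinear)

lemmas B_simps = add_left add_right diff_left diff_right scaleR_left scaleR_right zero_left zero_right
  minus_left minus_right

lemma on_quadric: "q \<in> M \<Longrightarrow> B q q = \<beta>"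
  by (simp add: M_eq)

lemma has_vector_derivative_form:
  assumes "(f has_vector_derivative f') (at s within J)" "(g has_vector_derivative g') (at s within J)"
  shows "((\<lambda>s. B (f s) (g s)) has_vector_derivative B (f s) g' + B f' (g s)) (at s within J)"
  using has_vector_derivative[OF assms] .

text \<open>The line \<open>p + s v\<close> is rescaled to the quadric. The scaling factor is even in \<open>s\<close>, so the
  velocity at \<open>0\<close> stays \<open>v\<close>. Because the curve does not leave the plane spanned by \<open>p\<close> and \<open>v\<close>, it
  also lies in every hyperplane section of \<open>M\<close> to which \<open>p\<close> and \<open>v\<close> belong.\<close>

lemma curve_with_velocity:
  assumes p: "p \<in> M" and v: "B v p = 0"
  obtains c e where "e > 0" "\<And>s. \<bar>s\<bar> < e \<Longrightarrow> c s \<in> M \<inter> span {p, v}" "c (0::real) = p"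
    "(c has_vector_derivative v) (at 0)"
proof -
  define a where "a = B v v / \<beta>"
  define c where "c s = (1 + s\<^sup>2 * a) powr (- 1 / 2) *\<^sub>R (p + s *\<^sub>R v)" for s :: real
  have c0: "c 0 = p" by (simp add: c_def)
  have der: "(c has_vector_derivative v) (at 0)"
    unfolding c_def [abs_def]
    by (rule derivative_eq_intros refl | simp)+
  have "isCont c 0"
    using der has_vector_derivative_continuous by blast
  moreover have "p \<in> \<Omega>" using p by (simp add: M_eq)
  ultimately have "\<forall>\<^sub>F s in nhds 0. c s \<in> \<Omega>"
    using open_\<Omega> c0 by (simp add: continuous_at_open eventually_nhds)
  moreover have "\<forall>\<^sub>F s in nhds (0::real). 1 + s\<^sup>2 * a > 0"
  proof -
    have "isCont (\<lambda>s::real. 1 + s\<^sup>2 * a) 0" by (intro continuous_intros)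
    then have "((\<lambda>s::real. 1 + s\<^sup>2 * a) \<longlongrightarrow> 1) (nhds 0)"
      by (simp add: isCont_def tendsto_nhds_iff)
    then show ?thesis
      by (rule order_tendstoD(1)) simp
  qed
  ultimately have "\<forall>\<^sub>F s in nhds 0. c s \<in> \<Omega> \<and> 1 + s\<^sup>2 * a > 0"
    by eventually_elim auto
  then obtain e where e: "e > 0" and near: "\<And>s. \<bar>s\<bar> < e \<Longrightarrow> c s \<in> \<Omega> \<and> 1 + s\<^sup>2 * a > 0"
    by (auto simp: eventually_nhds_metric)
  have "c s \<in> M \<inter> span {p, v}" if "\<bar>s\<bar> < e" for s
  proof -
    have pos: "1 + s\<^sup>2 * a > 0" using near[OF that] by simp
    have "B (p + s *\<^sub>R v) (p + s *\<^sub>R v) = \<beta> * (1 + s\<^sup>2 * a)"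
      using on_quadric[OF p] v sym[of p v] \<beta>_nonzero
      by (simp add: B_simps a_def algebra_simps power2_eq_square)
    moreover have "(1 + s\<^sup>2 * a) powr (- 1 / 2) * (1 + s\<^sup>2 * a) powr (- 1 / 2) = 1 / (1 + s\<^sup>2 * a)"
      using pos by (simp add: powr_minus_divide flip: powr_add)
    ultimately have "B (c s) (c s) = \<beta>"
      using pos unfolding c_def by (simp add: scaleR_left scaleR_right flip: mult.assoc)
    moreover have "c s \<in> span {p, v}"
      unfolding c_def by (intro span_scale span_add) (auto intro: span_base)
    ultimately show ?thesis
      using near[OF that] by (simp add: M_eq)
  qed
  with e c0 der show ?thesis using that by blast
qed

lemma tangent_space_subset:
  assumes "v \<in> tangent_space S p" "\<And>q. q \<in> S \<Longrightarrow> B q q = b"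
  shows "B v p = 0"
proof -
  obtain c e where e: "e > 0" "\<And>s. \<bar>s\<bar> < e \<Longrightarrow> c s \<in> S" "c (0::real) = p" "(c has_vector_derivative v) (at 0)"
    using assms(1) unfolding tangent_space_def by blast
  have "((\<lambda>s. B (c s) (c s)) has_vector_derivative B p v + B v p) (at 0)"
    using has_vector_derivative_form[OF e(4,4)] e(3) by simp
  then have "((\<lambda>s. b) has_vector_derivative B p v + B v p) (at 0)"
    by (rule has_vector_derivative_transform_within_open[where S="{-e<..<e}"]) (use e assms(2) in auto)
  then have "B p v + B v p = 0"
    using has_vector_derivative_const vector_derivative_unique_at by blast
  then show ?thesis using sym[of p v] by simp
qed

lemma tangent_space_eq:
  assumes "p \<in> M"
  shows "tangent_space M p = {v. B v p = 0}"
proof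
  show "tangent_space M p \<subseteq> {v. B v p = 0}"
    using tangent_space_subset on_quadric by blast
  show "{v. B v p = 0} \<subseteq> tangent_space M p"
    unfolding tangent_space_def using curve_with_velocity[OF assms] by (smt (verit) IntD1 mem_Collect_eq subsetI)
qed

text \<open>The normal space of \<open>M\<close> at \<open>p\<close> is the line through \<open>p\<close>: subtracting the projection to this
  line leaves a tangent vector that is orthogonal to itself.\<close>

lemma normal_direction:
  assumes p: "p \<in> M" and orth: "\<And>u. B u p = 0 \<Longrightarrow> B v u = 0"
  shows "v = (B v p / \<beta>) *\<^sub>R p"
proof (rule ccontr)
  define u where "u = v - (B v p / \<beta>) *\<^sub>R p"
  assume "v \<noteq> (B v p / \<beta>) *\<^sub>R p"
  then have "u \<noteq> 0" by (simp add: u_def)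
  have up: "B u p = 0"
    unfolding u_def using on_quadric[OF p] \<beta>_nonzero by (simp add: B_simps)
  then have "B v u = 0" using orth by blast
  moreover have "B u u = B v u - (B v p / \<beta>) * B u p"
    unfolding u_def by (simp add: B_simps sym[of v p] algebra_simps)
  ultimately show False using positive[OF p up \<open>u \<noteq> 0\<close>] up by simp
qed

lemma velocity_orthogonal:
  assumes J: "parameter_interval J" and s: "s \<in> J" and \<gamma>: "\<gamma> ` J \<subseteq> M"
    and d: "(\<gamma> has_vector_derivative v) (at s within J)"
  shows "B v (\<gamma> s) = 0"
proof -
  have "B (\<gamma> s) v + B v (\<gamma> s) = 0"
    by (rule vector_derivative_of_constant[OF J s has_vector_derivative_form[OF d d], of \<beta>])
      (use \<gamma> on_quadric in blast)
  then show ?thesis using sym[of v "\<gamma> s"] by simp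
qed

text \<open>By the frame equation the derivative of \<open>n i\<close> differs from \<open>- \<kappa> i t\<close> by a multiple of \<open>\<alpha>\<close>.
  Differentiating \<open>B (n i) \<alpha> = 0\<close> shows that the multiple is zero.\<close>

lemma frame_derivative:
  assumes I: "parameter_interval I" and \<alpha>: "\<alpha> ` I \<subseteq> M"
    and frame: "rotation_minimizing_frame B M m I \<alpha> t n \<kappa>" and s: "s \<in> I" and i: "i \<in> {1..m}"
  shows "(n i has_vector_derivative - \<kappa> i s *\<^sub>R t s) (at s within I)"
proof -
  have \<alpha>M: "\<alpha> s \<in> M" if "s \<in> I" for s using \<alpha> that by auto
  have t: "(\<alpha> has_vector_derivative t s) (at s within I)" if "s \<in> I" for s
    using frame that unfolding rotation_minimizing_frame_def by blast
  have n\<alpha>: "B (n i s) (\<alpha> s) = 0" if s: "s \<in> I" for s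
  proof -
    have "n i s \<in> tangent_space M (\<alpha> s)"
      using frame i s unfolding rotation_minimizing_frame_def by (metis image_eqI insertCI span_base)
    then show ?thesis using tangent_space_eq[OF \<alpha>M[OF s]] by simp
  qed
  have nt: "B (n i s) (t s) = 0"
    using frame i s sym unfolding rotation_minimizing_frame_def by metis
  obtain D where D: "(n i has_vector_derivative D) (at s within I)"
    and orth: "\<And>u. B u (\<alpha> s) = 0 \<Longrightarrow> B (D - (- \<kappa> i s *\<^sub>R t s)) u = 0"
    using frame i s tangent_space_eq[OF \<alpha>M[OF s]]
    unfolding rotation_minimizing_frame_def has_covariant_derivative_def by blast
  have "B (n i s) (t s) + B D (\<alpha> s) = 0"
    by (rule vector_derivative_of_constant[OF I s has_vector_derivative_form[OF D t[OF s]], of 0]) (rule n\<alpha>)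
  then have "B (D - (- \<kappa> i s *\<^sub>R t s)) (\<alpha> s) = 0"
    using nt velocity_orthogonal[OF I s \<alpha> t[OF s]] by (simp add: B_simps)
  then have "D - (- \<kappa> i s *\<^sub>R t s) = 0"
    using normal_direction[OF \<alpha>M[OF s] orth] by simp
  then have "D = - \<kappa> i s *\<^sub>R t s"
    by (rule eq_iff_diff_eq_0[THEN iffD2])
  with D show ?thesis by simp
qed

end

section \<open>Hyperplane sections of a space form\<close>

context space_form
begin

lemma hyperplane_section_dim:
  assumes p: "p \<in> M" and N: "B N N > 0" and pN: "B p N = 0"
  shows "dim {x. B x p = 0 \<and> B x N = 0} = DIM('a) - 2"
proof -
  let ?E = "{x. B x p = 0 \<and> B x N = 0}" and ?P = "span {p, N}"
  have sub: "subspace ?E"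
    by (auto simp: subspace_def B_simps)
  have Bp: "B p p = \<beta>" and Np: "B N p = 0" using on_quadric p sym pN by auto
  have "p \<noteq> 0" using Bp \<beta>_nonzero zero_left by metis
  moreover have "N \<notin> span {p}"
    using N pN Np by (auto simp: span_singleton B_simps)
  ultimately have "dim ?P = 2"
    by (simp add: dim_insert insert_commute[of p] )
  moreover have "?P \<inter> ?E = {0}"
  proof
    show "?P \<inter> ?E \<subseteq> {0}"
    proof
      fix x assume x: "x \<in> ?P \<inter> ?E"
      then obtain a b where "x = a *\<^sub>R p + b *\<^sub>R N"
        by (auto simp: span_insert span_singleton algebra_simps)
      with x Bp Np pN N \<beta>_nonzero show "x \<in> {0}"
        by (auto simp: B_simps)
    qed
    show "{0} \<subseteq> ?P \<inter> ?E" by (auto simp: B_simps span_zero)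
  qed
  moreover have "{x + y |x y. x \<in> ?P \<and> y \<in> ?E} = UNIV"
  proof -
    have "\<exists>x\<in>?P. \<exists>y\<in>?E. v = x + y" for v
    proof (intro bexI)
      let ?x = "(B v p / \<beta>) *\<^sub>R p + (B v N / B N N) *\<^sub>R N"
      show "v = ?x + (v - ?x)" by simp
      show "v - ?x \<in> ?E"
        using Bp Np pN N \<beta>_nonzero by (auto simp: B_simps)
      show "?x \<in> ?P"
        by (intro span_add span_scale) (auto intro: span_base)
    qed
    then show ?thesis by blast
  qed
  ultimately show ?thesis
    using dim_sums_Int[OF subspace_span sub, of "{p, N}"] by simp
qed

text \<open>The chart at \<open>p\<close> writes \<open>q = x + \<tau> p\<close> with \<open>x\<close> orthogonal to \<open>p\<close> and replaces the
  coordinate \<open>\<tau>\<close> by the defining function \<open>B q q - \<beta>\<close> of the quadric. The inverse recovers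
  \<open>\<tau>\<close> as a square root, the positive one, which is why the chart is restricted to \<open>\<tau> > 0\<close>. Since
  \<open>x\<close> is unchanged and \<open>p\<close> is orthogonal to \<open>N\<close>, the chart straightens \<open>M\<close> and the hyperplane
  at the same time.\<close>

lemma hyperplane_section_submanifold:
  assumes N: "B N N > 0"
  shows "submanifold (DIM('a) - 2) (M \<inter> {q. B q N = 0})" (is "submanifold _ ?S")
  unfolding submanifold_def
proof
  fix p assume pS: "p \<in> ?S"
  then have p: "p \<in> M" and pN: "B p N = 0" by auto
  then have Bp: "B p p = \<beta>" and p\<Omega>: "p \<in> \<Omega>" by (simp_all add: M_eq)
  define \<Phi> where "\<Phi> q = q + (B q q - \<beta> - B q p / \<beta>) *\<^sub>R p" for q
  \<comment> \<open>This is \<open>\<tau>\<^sup>2\<close> as a function of the image point \<open>y = \<Phi> q\<close>.\<close>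
  define \<rho> where "\<rho> y = (B y p / \<beta> + \<beta> - B y y + (B y p / \<beta>)\<^sup>2 * \<beta>) / \<beta>" for y
  define \<Psi> where "\<Psi> y = y + (\<rho> y powr (1 / 2) - B y p / \<beta>) *\<^sub>R p" for y
  define U where "U = {q \<in> \<Omega>. B q p / \<beta> > 0}"
  define V\<^sub>0 where "V\<^sub>0 = {y. \<rho> y > 0}"
  define V where "V = {y \<in> V\<^sub>0. \<Psi> y \<in> \<Omega>}"
  define E where "E = {x. B x p = 0 \<and> B x N = 0}"
  have smooth_q: "Ck_on k (\<lambda>y. B y y) X" if "open X" for k X
    by (intro Ck_on_prod Ck_on_linear bounded_linear_ident that)
  have smooth_l: "Ck_on k (\<lambda>y. B y p / \<beta>) X" if "open X" for k X
    using that by (intro Ck_on_linear bounded_linear_compose[OF bounded_linear_divide bounded_linear_left])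
  have smooth_add: "Ck_on k (\<lambda>y. f y + g y) X" "Ck_on k (\<lambda>y. f y - g y) X"
    if "open X" "Ck_on k f X" "Ck_on k g X" for k X and f g :: "'a \<Rightarrow> real"
    using Ck_on_add[OF that] Ck_on_add[OF that(1,2) Ck_on_linear_outer[OF that(1) bounded_linear_minus[OF bounded_linear_ident] that(3)]]
    by auto
  have smooth_\<rho>: "Ck_on k \<rho> X" if X: "open X" for k X
  proof -
    have "Ck_on k (\<lambda>y. B y p / \<beta> + \<beta> - B y y + ((B y p / \<beta>) * (B y p / \<beta>)) * \<beta>) X"
      using X by (intro smooth_add Ck_on_const smooth_q smooth_l bounded_bilinear.Ck_on_prod[OF bounded_bilinear_mult])
    from Ck_on_linear_outer[OF X bounded_linear_divide this, of \<beta>] show ?thesis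
      by (simp add: \<rho>_def [abs_def] power2_eq_square)
  qed
  have smooth_shift: "Ck_on k (\<lambda>y. y + f y *\<^sub>R p) X" if "open X" "Ck_on k f X" for k X and f :: "'a \<Rightarrow> real"
    by (intro Ck_on_add Ck_on_linear bounded_linear_ident that Ck_on_linear_outer[OF _ bounded_linear_scaleR_left])
  have smooth_\<Phi>: "Ck_on k \<Phi> X" if "open X" for k X
    unfolding \<Phi>_def [abs_def] using that
    by (intro smooth_shift smooth_add smooth_q smooth_l Ck_on_const)
  have open_V\<^sub>0: "open V\<^sub>0"
  proof -
    have "continuous_on UNIV \<rho>"
      using smooth_\<rho>[of UNIV 0] by simp
    then show ?thesis
      unfolding V\<^sub>0_def by (intro open_Collect_less continuous_on_const)
  qed
  have smooth_\<Psi>: "Ck_on k \<Psi> V\<^sub>0" for k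
    unfolding \<Psi>_def [abs_def] using open_V\<^sub>0
    by (intro smooth_shift smooth_add smooth_l Ck_on_powr smooth_\<rho>) (auto simp: V\<^sub>0_def)
  have open_U: "open U"
  proof -
    have "open {q. 0 < B q p / \<beta>}"
      using smooth_l[of UNIV 0] by (intro open_Collect_less) auto
    moreover have "U = \<Omega> \<inter> {q. 0 < B q p / \<beta>}" by (auto simp: U_def)
    ultimately show ?thesis using open_\<Omega> by (metis open_Int)
  qed
  have open_V: "open V"
    using continuous_open_preimage[OF Ck_on_imp_continuous[OF smooth_\<Psi>] open_V\<^sub>0 open_\<Omega>]
    by (simp add: V_def vimage_def Int_def)
  have \<Phi>p: "B (\<Phi> q) p / \<beta> = B q q - \<beta>" for q
    using \<beta>_nonzero Bp by (simp add: \<Phi>_def B_simps field_simps)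
  have \<rho>\<Phi>: "\<rho> (\<Phi> q) = (B q p / \<beta>)\<^sup>2" for q
  proof -
    define \<tau> where "\<tau> = B q p / \<beta>"
    define c where "c = B q q - \<beta> - \<tau>"
    have qp: "B q p = \<tau> * \<beta>" using \<beta>_nonzero by (simp add: \<tau>_def)
    have "B (\<Phi> q) (\<Phi> q) = B q q + 2 * c * (\<tau> * \<beta>) + c\<^sup>2 * \<beta>"
      unfolding \<Phi>_def \<tau>_def[symmetric] c_def[symmetric] using Bp sym[of p q] qp
      by (simp add: B_simps algebra_simps power2_eq_square)
    moreover have "B q q - \<beta> = c + \<tau>" by (simp add: c_def)
    ultimately have "B q q - \<beta> + \<beta> - B (\<Phi> q) (\<Phi> q) + (B q q - \<beta>)\<^sup>2 * \<beta> = \<tau>\<^sup>2 * \<beta>"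
      by (simp add: algebra_simps power2_eq_square)
    then show ?thesis
      unfolding \<rho>_def \<Phi>p \<tau>_def[symmetric] using \<beta>_nonzero by simp
  qed
  have \<Psi>\<Phi>: "\<Psi> (\<Phi> q) = q" if "B q p / \<beta> > 0" for q
  proof -
    have "c\<^sup>2 powr (1 / 2) = c" if "c > 0" for c :: real
      using that by (simp add: powr_half_sqrt)
    then have "((B q p / \<beta>)\<^sup>2) powr (1 / 2) = B q p / \<beta>"
      using that by blast
    then have "\<Psi> (\<Phi> q) = \<Phi> q + (B q p / \<beta> - (B q q - \<beta>)) *\<^sub>R p"
      unfolding \<Psi>_def \<Phi>p \<rho>\<Phi> by simp
    then show ?thesis
      by (simp add: \<Phi>_def algebra_simps)
  qed
  have \<Psi>p: "B (\<Psi> y) p / \<beta> = \<rho> y powr (1 / 2)" for y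
    using \<beta>_nonzero Bp by (simp add: \<Psi>_def B_simps field_simps)
  have \<Psi>\<Psi>: "B (\<Psi> y) (\<Psi> y) = B y p / \<beta> + \<beta>" if "\<rho> y > 0" for y
  proof -
    define r where "r = \<rho> y powr (1 / 2)"
    define \<sigma> where "\<sigma> = B y p / \<beta>"
    have "r\<^sup>2 = \<rho> y" using that by (simp add: r_def powr_half_sqrt)
    then have r: "r\<^sup>2 * \<beta> = \<sigma> + \<beta> - B y y + \<sigma>\<^sup>2 * \<beta>"
      using \<beta>_nonzero by (simp add: \<rho>_def \<sigma>_def)
    have yp: "B y p = \<sigma> * \<beta>" using \<beta>_nonzero by (simp add: \<sigma>_def)
    have "B (\<Psi> y) (\<Psi> y) = B y y + 2 * (r - \<sigma>) * (\<sigma> * \<beta>) + (r - \<sigma>)\<^sup>2 * \<beta>"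
      unfolding \<Psi>_def r_def[symmetric] \<sigma>_def[symmetric] using Bp sym[of p y] yp
      by (simp add: B_simps algebra_simps power2_eq_square)
    also have "\<dots> = B y y + r\<^sup>2 * \<beta> - \<sigma>\<^sup>2 * \<beta>"
      by (simp add: algebra_simps power2_eq_square)
    finally show ?thesis using r by (simp add: \<sigma>_def)
  qed
  have \<Phi>\<Psi>: "\<Phi> (\<Psi> y) = y" if "\<rho> y > 0" for y
  proof -
    have "\<Phi> (\<Psi> y) = \<Psi> y + (B y p / \<beta> - \<rho> y powr (1 / 2)) *\<^sub>R p"
      unfolding \<Phi>_def \<Psi>p \<Psi>\<Psi>[OF that] by simp
    then show ?thesis by (simp add: \<Psi>_def algebra_simps)
  qed
  have UV: "\<Phi> q \<in> V" if "q \<in> U" for q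
    using that \<Psi>\<Phi>[of q] \<rho>\<Phi>[of q] by (auto simp: U_def V_def V\<^sub>0_def)
  have VU: "\<Psi> y \<in> U" if "y \<in> V" for y
    using that \<Psi>p[of y] by (auto simp: U_def V_def V\<^sub>0_def)
  have "homeomorphism U V \<Phi> \<Psi>"
    unfolding homeomorphism_def
  proof (intro conjI ballI)
    show "continuous_on U \<Phi>"
      by (rule Ck_on_imp_continuous[OF smooth_\<Phi>[OF open_U, of 0]])
    show "continuous_on V \<Psi>"
      by (rule continuous_on_subset[OF Ck_on_imp_continuous[OF smooth_\<Psi>[of 0]]]) (auto simp: V_def)
    show "\<Psi> (\<Phi> q) = q" if "q \<in> U" for q using \<Psi>\<Phi> that by (simp add: U_def)
    show "\<Phi> (\<Psi> y) = y" if "y \<in> V" for y using \<Phi>\<Psi> that by (simp add: V_def V\<^sub>0_def)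
    show "\<Phi> ` U = V"
      using UV VU \<Phi>\<Psi> by (force simp: V_def V\<^sub>0_def image_iff)
    show "\<Psi> ` V = U"
      using UV VU \<Psi>\<Phi> by (force simp: U_def image_iff)
  qed
  then have "diffeomorphism_between U V \<Phi>"
    unfolding diffeomorphism_between_def smooth_map_on_def
    using open_U open_V smooth_\<Phi>[OF open_U] Ck_on_subset[OF smooth_\<Psi>, of V] V_def by blast
  moreover have "p \<in> U"
    using p\<Omega> Bp \<beta>_nonzero by (simp add: U_def)
  moreover have "subspace E"
    by (auto simp: E_def subspace_def B_simps)
  moreover have "dim E = DIM('a) - 2"
    unfolding E_def by (rule hyperplane_section_dim[OF p N pN])
  moreover have "\<Phi> ` (?S \<inter> U) = E \<inter> V"
  proof safe
    fix q assume q: "q \<in> M" "B q N = 0" "q \<in> U"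
    show "\<Phi> q \<in> V" using UV q by blast
    have "B (\<Phi> q) N = 0" using q pN by (simp add: \<Phi>_def B_simps)
    moreover have "B (\<Phi> q) p = 0" using \<Phi>p[of q] on_quadric[OF q(1)] \<beta>_nonzero by simp
    ultimately show "\<Phi> q \<in> E" by (simp add: E_def)
  next
    fix y assume y: "y \<in> E" "y \<in> V"
    then have "\<rho> y > 0" "B y p = 0" "B y N = 0" by (auto simp: V_def V\<^sub>0_def E_def)
    then have "\<Psi> y \<in> ?S"
      using \<Psi>\<Psi>[of y] y pN by (auto simp: M_eq V_def \<Psi>_def B_simps)
    then show "y \<in> \<Phi> ` (?S \<inter> U)"
      using \<Phi>\<Psi>[OF \<open>\<rho> y > 0\<close>] VU[OF y(2)] by (metis IntI image_eqI)
  qed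
  ultimately show "\<exists>U V \<Phi> E. p \<in> U \<and> diffeomorphism_between U V (\<Phi> :: 'a \<Rightarrow> 'a) \<and>
        subspace E \<and> dim E = DIM('a) - 2 \<and> \<Phi> ` (?S \<inter> U) = E \<inter> V"
    by blast
qed

text \<open>A tangent vector of \<open>M\<close> is the sum of one of the section and a multiple of \<open>N\<close>. The
  acceleration of a curve in the section is orthogonal to \<open>N\<close>, so it is normal to \<open>M\<close> as soon as it is
  normal to the section.\<close>

lemma hyperplane_section_totally_geodesic:
  assumes N: "B N N > 0"
  shows "totally_geodesic_submanifold B M (DIM('a) - 2) (M \<inter> {q. B q N = 0})"
    (is "totally_geodesic_submanifold _ _ _ ?S")
  unfolding totally_geodesic_submanifold_def
proof (intro conjI allI impI hyperplane_section_submanifold N)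
  fix J and \<gamma> :: "real \<Rightarrow> 'a" assume geo: "geodesic B ?S J \<gamma>"
  then have J: "parameter_interval J" and \<gamma>S: "\<gamma> ` J \<subseteq> ?S" and C2: "C2_curve J \<gamma>"
    unfolding geodesic_def by auto
  obtain \<gamma>' where \<gamma>': "\<And>s. s \<in> J \<Longrightarrow> (\<gamma> has_vector_derivative \<gamma>' s) (at s within J)"
    and cov: "\<And>s. s \<in> J \<Longrightarrow> has_covariant_derivative B ?S J \<gamma> \<gamma>' 0 s"
    using geo unfolding geodesic_def by blast
  have \<gamma>'N: "B (\<gamma>' s) N = 0" if "s \<in> J" for s
    by (rule vector_derivative_of_constant[OF J that bounded_linear.has_vector_derivative[OF bounded_linear_left \<gamma>'[OF that]], of _ 0])
      (use \<gamma>S in auto)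
  have "has_covariant_derivative B M J \<gamma> \<gamma>' 0 s" if s: "s \<in> J" for s
  proof -
    have \<gamma>s: "\<gamma> s \<in> M" "B (\<gamma> s) N = 0" using \<gamma>S s by auto
    obtain D where D: "(\<gamma>' has_vector_derivative D) (at s within J)"
      and orth: "\<And>u. u \<in> tangent_space ?S (\<gamma> s) \<Longrightarrow> B D u = 0"
      using cov[OF s] unfolding has_covariant_derivative_def by auto
    have DN: "B D N = 0"
      by (rule vector_derivative_of_constant[OF J s bounded_linear.has_vector_derivative[OF bounded_linear_left D], of _ 0])
        (rule \<gamma>'N)
    have "B D u = 0" if u: "B u (\<gamma> s) = 0" for u
    proof -
      define v where "v = u - (B u N / B N N) *\<^sub>R N"
      have v: "B v (\<gamma> s) = 0" "B v N = 0"
        using u \<gamma>s sym[of N "\<gamma> s"] N by (simp_all add: v_def B_simps)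
      obtain c e where "e > 0" "\<And>s'. \<bar>s'\<bar> < e \<Longrightarrow> c s' \<in> M \<inter> span {\<gamma> s, v}" "c (0::real) = \<gamma> s"
        "(c has_vector_derivative v) (at 0)"
        using curve_with_velocity[OF \<gamma>s(1) v(1)] by metis
      moreover have "span {\<gamma> s, v} \<subseteq> {q. B q N = 0}"
        by (rule span_minimal) (use \<gamma>s v in \<open>auto simp: subspace_def B_simps\<close>)
      ultimately have "v \<in> tangent_space ?S (\<gamma> s)"
        unfolding tangent_space_def by blast
      then have "B D v = 0" by (rule orth)
      then show ?thesis using DN by (simp add: v_def B_simps)
    qed
    then show ?thesis
      unfolding has_covariant_derivative_def tangent_space_eq[OF \<gamma>s(1)]
      using D by (auto simp: B_simps)
  qed
  then show "geodesic B M J \<gamma>"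
    unfolding geodesic_def using J \<gamma>S C2 \<gamma>' by blast
qed auto

text \<open>The vector field \<open>\<Sum> a i n i\<close> has derivative \<open>- (\<Sum> a i \<kappa> i) t = 0\<close>, so it is constant, and
  it is orthogonal to \<open>\<alpha>\<close>.\<close>

lemma plane_curve_if_curvature_relation:
  assumes dim: "DIM('a) = m + 2" and I: "parameter_interval I" and \<alpha>: "\<alpha> ` I \<subseteq> M"
    and frame: "rotation_minimizing_frame B M m I \<alpha> t n \<kappa>"
    and a: "i \<in> {1..m}" "a i \<noteq> 0" and rel: "\<And>s. s \<in> I \<Longrightarrow> (\<Sum>i=1..m. a i * \<kappa> i s) = 0"
  shows "plane_curve B M (m + 1) I \<alpha>"
proof -
  define N where "N s = (\<Sum>i=1..m. a i *\<^sub>R n i s)" for s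
  have "(N has_vector_derivative 0) (at s within I)" if s: "s \<in> I" for s
  proof -
    have "(N has_vector_derivative (\<Sum>i=1..m. a i *\<^sub>R (- \<kappa> i s *\<^sub>R t s))) (at s within I)"
      unfolding N_def [abs_def]
      by (intro has_vector_derivative_sum bounded_linear.has_vector_derivative[OF bounded_linear_scaleR_right]
          frame_derivative[OF I \<alpha> frame s])
    moreover have "(\<Sum>i=1..m. a i *\<^sub>R (- \<kappa> i s *\<^sub>R t s)) = - (\<Sum>i=1..m. a i * \<kappa> i s) *\<^sub>R t s"
      by (simp add: scaleR_sum_left sum_negf)
    ultimately show ?thesis using rel[OF s] by simp
  qed
  moreover have "convex I"
    using I by (simp add: parameter_interval_def is_interval_convex)
  ultimately obtain N\<^sub>0 where N\<^sub>0: "\<And>s. s \<in> I \<Longrightarrow> N s = N\<^sub>0"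
    using has_vector_derivative_zero_constant by metis
  obtain s\<^sub>0 where s\<^sub>0: "s\<^sub>0 \<in> I"
    using I interior_subset by (fastforce simp: parameter_interval_def)
  have orthonormal: "B (n i s\<^sub>0) (n j s\<^sub>0) = (if i = j then 1 else 0)" if "i \<in> {1..m}" "j \<in> {1..m}" for i j
    using frame s\<^sub>0 that unfolding rotation_minimizing_frame_def by blast
  have "B (N s\<^sub>0) (N s\<^sub>0) = (\<Sum>i=1..m. \<Sum>j=1..m. a i * a j * B (n i s\<^sub>0) (n j s\<^sub>0))"
    unfolding N_def sum_left sum_right scaleR_left scaleR_right by (simp add: mult.assoc sum_distrib_left sym)
  also have "\<dots> = (\<Sum>i=1..m. \<Sum>j=1..m. if j = i then a i * a i else 0)"
    by (intro sum.cong refl) (auto simp: orthonormal)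
  also have "\<dots> = (\<Sum>i=1..m. (a i)\<^sup>2)"
    by (simp add: power2_eq_square)
  also have "\<dots> > 0"
    using a by (intro sum_pos2[of _ i]) auto
  finally have pos: "B N\<^sub>0 N\<^sub>0 > 0" using N\<^sub>0[OF s\<^sub>0] by simp
  have "B (\<alpha> s) N\<^sub>0 = 0" if s: "s \<in> I" for s
  proof -
    have \<alpha>s: "\<alpha> s \<in> M" using \<alpha> s by blast
    have "n i s \<in> tangent_space M (\<alpha> s)" if "i \<in> {1..m}" for i
      using frame that s unfolding rotation_minimizing_frame_def by (metis image_eqI insertCI span_base)
    then have "B (\<alpha> s) (N s) = 0"
      unfolding N_def tangent_space_eq[OF \<alpha>s] by (auto simp: sum_right B_simps sym[of "\<alpha> s"])
    then show ?thesis using N\<^sub>0[OF s] by simp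
  qed
  then have "\<alpha> ` I \<subseteq> M \<inter> {q. B q N\<^sub>0 = 0}" using \<alpha> by auto
  then show ?thesis
    unfolding plane_curve_def using hyperplane_section_totally_geodesic[OF pos] dim
    by (intro exI[of _ m] exI[of _ "M \<inter> {q. B q N\<^sub>0 = 0}"]) auto
qed

end

section \<open>Charts and geodesics of a submanifold\<close>

text \<open>A chart of a submanifold \<open>S\<close> of \<open>M\<close>, with the inverse \<open>\<Psi>\<close> restricted to \<open>E\<close> as local
  parametrization.\<close>

locale submanifold_chart = space_form B M \<Omega> \<beta>
  for B :: "'a::euclidean_space \<Rightarrow> 'a \<Rightarrow> real" and M \<Omega> \<beta> +
  fixes S U V E :: "'a set" and \<Phi> \<Psi> :: "'a \<Rightarrow> 'a"
  assumes S_M: "S \<subseteq> M" and open_U: "open U" and open_V: "open V"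
    and smooth_\<Phi>: "Ck_on k \<Phi> U" and smooth_\<Psi>: "Ck_on k \<Psi> V"
    and homeo: "homeomorphism U V \<Phi> \<Psi>" and sub_E: "subspace E" and image: "\<Phi> ` (S \<inter> U) = E \<inter> V"
begin

text \<open>For \<open>w\<close> in \<open>E\<close>, \<open>D1 x w\<close> is a tangent vector of \<open>S\<close> at \<open>\<Psi> x\<close>, and \<open>D2 x w w\<close> is the part of
  the acceleration of \<open>\<Psi> \<circ> x\<close> that depends only on the velocity \<open>w = x'\<close>.\<close>

definition D1 where "D1 x w = frechet_derivative \<Psi> (at x) w"
definition D2 where "D2 x v w = frechet_derivative (\<lambda>y. D1 y w) (at x) v"

lemma \<Psi>\<Phi>: "q \<in> U \<Longrightarrow> \<Psi> (\<Phi> q) = q" and \<Phi>\<Psi>: "x \<in> V \<Longrightarrow> \<Phi> (\<Psi> x) = x"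
  and \<Phi>_V: "q \<in> U \<Longrightarrow> \<Phi> q \<in> V" and \<Psi>_U: "x \<in> V \<Longrightarrow> \<Psi> x \<in> U"
  using homeo by (auto simp: homeomorphism_def)

lemma \<Psi>_S: "x \<in> E \<Longrightarrow> x \<in> V \<Longrightarrow> \<Psi> x \<in> S"
proof -
  assume "x \<in> E" "x \<in> V"
  then have "x \<in> \<Phi> ` (S \<inter> U)" unfolding image by simp
  then obtain q where "q \<in> S" "q \<in> U" "\<Phi> q = x" by blast
  then show "\<Psi> x \<in> S" using \<Psi>\<Phi> by auto
qed

lemma \<Phi>_E: "q \<in> S \<Longrightarrow> q \<in> U \<Longrightarrow> \<Phi> q \<in> E"
  using image by blast

lemma smooth_D1: "Ck_on k (\<lambda>x. D1 x w) V"
  unfolding D1_def by (rule Ck_on_directional[OF open_V smooth_\<Psi>])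

lemma smooth_D2: "Ck_on k (\<lambda>x. D2 x v w) V"
  unfolding D2_def by (rule Ck_on_directional[OF open_V smooth_D1])

lemma D1_derivative: "x \<in> V \<Longrightarrow> (\<Psi> has_derivative D1 x) (at x)"
  using Ck_on_SucD(1)[OF smooth_\<Psi>] unfolding D1_def .

lemma D2_derivative: "x \<in> V \<Longrightarrow> ((\<lambda>y. D1 y w) has_derivative (\<lambda>v. D2 x v w)) (at x)"
  using Ck_on_SucD(1)[OF smooth_D1] unfolding D2_def .

lemma linear_D1: "x \<in> V \<Longrightarrow> linear (D1 x)"
  using D1_derivative has_derivative_linear by blast

lemma linear_D2_left: "x \<in> V \<Longrightarrow> linear (\<lambda>v. D2 x v w)"
  using D2_derivative has_derivative_linear by blast

lemma D2_symmetric: "x \<in> V \<Longrightarrow> D2 x v w = D2 x w v"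
  unfolding D2_def D1_def by (rule second_derivative_symmetric[OF open_V smooth_\<Psi>])

lemma linear_D2_right: "x \<in> V \<Longrightarrow> linear (D2 x v)"
  using linear_D2_left[of x v] D2_symmetric[of x] by presburger

lemma D1_inverse: "x \<in> V \<Longrightarrow> frechet_derivative \<Phi> (at (\<Psi> x)) (D1 x w) = w"
proof -
  assume x: "x \<in> V"
  have "((\<lambda>y. \<Phi> (\<Psi> y)) has_derivative (\<lambda>w. frechet_derivative \<Phi> (at (\<Psi> x)) (D1 x w))) (at x)"
    by (rule has_derivative_compose[OF D1_derivative[OF x] Ck_on_SucD(1)[OF smooth_\<Phi> \<Psi>_U[OF x]]])
  then have "((\<lambda>y. y) has_derivative (\<lambda>w. frechet_derivative \<Phi> (at (\<Psi> x)) (D1 x w))) (at x)"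
    by (rule has_derivative_transform_within_open[OF _ open_V x]) (rule \<Phi>\<Psi>)
  then have "(\<lambda>w. frechet_derivative \<Phi> (at (\<Psi> x)) (D1 x w)) = (\<lambda>w. w)"
    using has_derivative_unique has_derivative_ident by blast
  then show ?thesis by metis
qed

lemma D1_injective: "x \<in> V \<Longrightarrow> D1 x w = 0 \<Longrightarrow> w = 0"
  using D1_inverse[of x w] Ck_on_SucD(1)[OF smooth_\<Phi> \<Psi>_U[of x]] has_derivative_linear linear_0 by metis

text \<open>A curve in \<open>S\<close> through \<open>\<Psi> x\<close> is the image under \<open>\<Psi>\<close> of a curve in \<open>E\<close>, whose velocity lies
  in \<open>E\<close> because a subspace is closed.\<close>

lemma tangent_space_chart:
  assumes x: "x \<in> E" "x \<in> V"
  shows "tangent_space S (\<Psi> x) = D1 x ` E"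
proof
  show "D1 x ` E \<subseteq> tangent_space S (\<Psi> x)"
  proof
    fix v assume "v \<in> D1 x ` E"
    then obtain w where w: "w \<in> E" "v = D1 x w" by blast
    have "isCont (\<lambda>s::real. x + s *\<^sub>R w) 0" by (intro continuous_intros)
    then have "\<forall>\<^sub>F s in nhds 0. x + s *\<^sub>R w \<in> V"
      using open_V x(2) by (simp add: continuous_at_open eventually_nhds)
    then obtain e where e: "e > 0" "\<And>s. \<bar>s\<bar> < e \<Longrightarrow> x + s *\<^sub>R w \<in> V"
      by (auto simp: eventually_nhds_metric)
    have "((\<lambda>s. x + s *\<^sub>R w) has_derivative (\<lambda>h. h *\<^sub>R w)) (at 0)"
      by (auto intro!: derivative_eq_intros)
    from has_derivative_compose[OF this, of \<Psi> "D1 x"]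
    have "((\<lambda>s. \<Psi> (x + s *\<^sub>R w)) has_vector_derivative v) (at 0)"
      using D1_derivative[OF x(2)] linear_scale[OF linear_D1[OF x(2)]] w(2)
      by (simp add: has_vector_derivative_def)
    then show "v \<in> tangent_space S (\<Psi> x)"
      unfolding tangent_space_def
      using e \<Psi>_S subspace_add[OF sub_E x(1) subspace_scale[OF sub_E w(1)]]
      by (intro CollectI exI[of _ "\<lambda>s. \<Psi> (x + s *\<^sub>R w)"] exI[of _ e]) auto
  qed
  show "tangent_space S (\<Psi> x) \<subseteq> D1 x ` E"
  proof
    fix v assume "v \<in> tangent_space S (\<Psi> x)"
    then obtain c e where e: "e > 0" "\<And>s. \<bar>s\<bar> < e \<Longrightarrow> c s \<in> S" "c (0::real) = \<Psi> x"
      and der: "(c has_vector_derivative v) (at 0)"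
      unfolding tangent_space_def by blast
    have "isCont c 0" using der has_vector_derivative_continuous by blast
    then have "\<forall>\<^sub>F s in nhds 0. c s \<in> U"
      using open_U \<Psi>_U[OF x(2)] e(3) by (simp add: continuous_at_open eventually_nhds)
    then obtain d where d: "d > 0" "\<And>s. \<bar>s\<bar> < d \<Longrightarrow> c s \<in> U"
      by (auto simp: eventually_nhds_metric)
    define I where "I = {- min d e<..<min d e}"
    have I: "open I" "0 \<in> I" "\<And>s. s \<in> I \<Longrightarrow> c s \<in> S \<and> c s \<in> U"
      using d e by (auto simp: I_def)
    define w where "w = frechet_derivative \<Phi> (at (\<Psi> x)) v"
    have d\<Phi>: "(\<Phi> has_derivative frechet_derivative \<Phi> (at (\<Psi> x))) (at (c 0))"
      using Ck_on_SucD(1)[OF smooth_\<Phi> \<Psi>_U[OF x(2)]] e(3) by simp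
    have \<Phi>c: "((\<lambda>s. \<Phi> (c s)) has_vector_derivative w) (at 0)"
      using has_derivative_compose[OF der[unfolded has_vector_derivative_def] d\<Phi>]
        linear_scale[OF has_derivative_linear[OF d\<Phi>]]
      by (simp add: has_vector_derivative_def w_def)
    have "w \<in> E"
    proof (rule in_subspace_if_orthogonal[OF sub_E])
      fix n assume n: "\<And>e. e \<in> E \<Longrightarrow> n \<bullet> e = 0"
      have "((\<lambda>s. n \<bullet> \<Phi> (c s)) has_vector_derivative n \<bullet> w) (at 0)"
        by (rule bounded_linear.has_vector_derivative[OF bounded_linear_inner_right \<Phi>c])
      then have "((\<lambda>s. 0) has_vector_derivative n \<bullet> w) (at (0::real))"
        by (rule has_vector_derivative_transform_within_open[OF _ I(1,2)]) (use n I(3) \<Phi>_E in auto)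
      then show "n \<bullet> w = 0"
        using has_vector_derivative_const vector_derivative_unique_at by blast
    qed
    have \<Phi>c0: "\<Phi> (c 0) = x" using e(3) \<Phi>\<Psi>[OF x(2)] by simp
    have "((\<lambda>s. \<Psi> (\<Phi> (c s))) has_vector_derivative D1 x w) (at 0)"
      using has_derivative_compose[OF \<Phi>c[unfolded has_vector_derivative_def], of \<Psi> "D1 x"] D1_derivative[OF x(2)]
        linear_scale[OF linear_D1[OF x(2)]] \<Phi>c0
      by (simp add: has_vector_derivative_def)
    then have "(c has_vector_derivative D1 x w) (at 0)"
      by (rule has_vector_derivative_transform_within_open[OF _ I(1,2)]) (use I(3) \<Psi>\<Phi> in auto)
    then have "v = D1 x w" using der vector_derivative_unique_at by blast
    with \<open>w \<in> E\<close> show "v \<in> D1 x ` E" by blast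
  qed
qed

lemma tangent_orthogonal:
  assumes "x \<in> E" "x \<in> V" "w \<in> E"
  shows "B (D1 x w) (\<Psi> x) = 0"
proof -
  have "D1 x w \<in> tangent_space S (\<Psi> x)"
    unfolding tangent_space_chart[OF assms(1,2)] using assms(3) by (rule imageI)
  then show ?thesis
    by (rule tangent_space_subset) (rule on_quadric[OF subsetD[OF S_M]])
qed

lemma form_positive:
  assumes "x \<in> E" "x \<in> V" "w \<in> E" "w \<noteq> 0"
  shows "B (D1 x w) (D1 x w) > 0"
  using positive[OF _ tangent_orthogonal[OF assms(1-3)]] \<Psi>_S[OF assms(1,2)] S_M D1_injective assms by blast

lemma open_V_UNIV: "open (V \<times> (UNIV :: 'a set))"
  using open_V by (intro open_Times) auto

lemma smooth_D1_joint: "Ck_on k (\<lambda>z. D1 (fst z) (snd z)) (V \<times> UNIV)"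
  by (rule Ck_on_evaluate[OF open_V linear_D1 smooth_D1])

lemma smooth_D2_diagonal: "Ck_on k (\<lambda>z. D2 (fst z) (snd z) (snd z)) (V \<times> UNIV)"
proof (rule Ck_on_cong[OF open_V_UNIV])
  show "(\<Sum>b\<in>Basis. (snd z \<bullet> b) *\<^sub>R D2 (fst z) b (snd z)) = D2 (fst z) (snd z) (snd z)"
    if "z \<in> V \<times> UNIV" for z
    by (rule linear_eq_sum_Basis[OF linear_D2_left, symmetric]) (use that in \<open>simp add: mem_Times_iff\<close>)
  have "Ck_on k (\<lambda>z. (snd z \<bullet> b) *\<^sub>R D2 (fst z) b (snd z)) (V \<times> UNIV)" for b
  proof (rule bounded_bilinear.Ck_on_prod[OF bounded_bilinear_scaleR open_V_UNIV])
    show "Ck_on k (\<lambda>z. snd z \<bullet> b) (V \<times> UNIV)"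
      by (rule Ck_on_linear[OF open_V_UNIV]) (rule bounded_linear_intros)+
    show "Ck_on k (\<lambda>z. D2 (fst z) b (snd z)) (V \<times> UNIV)"
      by (rule Ck_on_evaluate[OF open_V linear_D2_right smooth_D2])
  qed
  then show "Ck_on k (\<lambda>z. \<Sum>b\<in>Basis. (snd z \<bullet> b) *\<^sub>R D2 (fst z) b (snd z)) (V \<times> UNIV)"
    by (rule Ck_on_sum[OF open_V_UNIV])
qed

text \<open>Positivity becomes uniform by minimizing over the compact set of pairs of a base point and a unit
  direction. This bound replaces an explicit inverse of the Gram matrix of the parametrization.\<close>

lemma coercive:
  assumes K: "compact K" "K \<subseteq> E \<inter> V"
  obtains \<mu> where "\<mu> > 0" "\<And>x u. x \<in> K \<Longrightarrow> u \<in> E \<Longrightarrow> \<mu> * (norm u)\<^sup>2 \<le> B (D1 x u) (D1 x u)"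
proof -
  let ?X = "K \<times> (E \<inter> sphere 0 1)" and ?f = "\<lambda>z. B (D1 (fst z) (snd z)) (D1 (fst z) (snd z))"
  have "\<exists>\<mu>>0. \<forall>z\<in>?X. \<mu> \<le> ?f z"
  proof (cases "?X = {}")
    case True
    then have "\<forall>z\<in>?X. 1 \<le> ?f z" by (subst True) simp
    then show ?thesis using zero_less_one by blast
  next
    case False
    have "compact ?X"
      using K(1) closed_subspace[OF sub_E] by (intro compact_Times closed_Int_compact) auto
    moreover have "continuous_on ?X ?f"
      using K(2) by (intro continuous_on continuous_on_subset[OF Ck_on_imp_continuous[OF smooth_D1_joint[of 0]]]) auto
    ultimately obtain z where z: "z \<in> ?X" "\<And>y. y \<in> ?X \<Longrightarrow> ?f z \<le> ?f y"
      using continuous_attains_inf[of ?X ?f] False by metis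
    then have "?f z > 0"
      using K(2) by (intro form_positive) auto
    with z show ?thesis by blast
  qed
  then obtain \<mu> where \<mu>: "\<mu> > 0" "\<And>z. z \<in> ?X \<Longrightarrow> \<mu> \<le> ?f z" by blast
  have "\<mu> * (norm u)\<^sup>2 \<le> B (D1 x u) (D1 x u)" if x: "x \<in> K" and u: "u \<in> E" for x u
  proof (cases "u = 0")
    case True
    then show ?thesis using linear_0[OF linear_D1[of x]] x K(2) by (auto simp: B_simps)
  next
    case False
    define e where "e = u /\<^sub>R norm u"
    have e: "e \<in> E" "norm e = 1" "u = norm u *\<^sub>R e"
      using False u subspace_scale[OF sub_E] by (auto simp: e_def)
    have "B (D1 x u) (D1 x u) = (norm u)\<^sup>2 * B (D1 x e) (D1 x e)"
      using linear_scale[OF linear_D1[of x], of "norm u" e] x K(2) e(3)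
      by (auto simp: scaleR_left scaleR_right power2_eq_square)
    moreover have "\<mu> \<le> B (D1 x e) (D1 x e)"
      using \<mu>(2)[of "(x, e)"] x e by simp
    ultimately show ?thesis
      by (simp add: mult.commute[of \<mu>] mult_left_mono)
  qed
  with \<mu>(1) show ?thesis using that by blast
qed

text \<open>In the chart, the geodesic equation is \<open>x'' = a\<close>, where \<open>a\<close> makes the ambient acceleration
  \<open>D2 x w w + D1 x a\<close> orthogonal to the tangent space, \<open>w\<close> being the velocity \<open>x'\<close>.\<close>

lemma acceleration_exists:
  assumes x: "x \<in> E" "x \<in> V"
  shows "\<exists>a\<in>E. \<forall>e\<in>E. B (D1 x a) (D1 x e) = - B (D2 x w w) (D1 x e)"
proof -
  have bl: "bounded_linear (D1 x)"
    using linear_D1[OF x(2)] linear_conv_bounded_linear by blast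
  have "linear (\<lambda>e. - B (D2 x w w) (D1 x e))"
    by (intro bounded_linear.linear bounded_linear_minus bounded_linear_compose[OF bounded_linear_right bl])
  then show ?thesis
    by (intro positive_definite_represents sub_E comp bl form_positive x)
qed

text \<open>The acceleration is the solution \<open>a\<close> of a linear equation \<open>G (x, a) = - H (x, w)\<close> (tested
  against \<open>E\<close>) whose data are continuously differentiable, hence Lipschitz on compact sets. Coercivity
  bounds the solution by some \<open>R\<close>, and, applied to the difference \<open>d\<close> of two solutions, bounds \<open>d\<close> by the
  variation of the data.\<close>

lemma acceleration_lipschitz:
  assumes \<epsilon>: "\<epsilon> > 0" and V: "cball x\<^sub>0 \<epsilon> \<subseteq> V"
    and acc: "\<And>x w. x \<in> E \<Longrightarrow> x \<in> V \<Longrightarrow> acc x w \<in> E"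
      "\<And>x w e. x \<in> E \<Longrightarrow> x \<in> V \<Longrightarrow> e \<in> E \<Longrightarrow> B (D1 x (acc x w)) (D1 x e) = - B (D2 x w w) (D1 x e)"
  obtains L where "L-lipschitz_on ((E \<times> E) \<inter> cball (x\<^sub>0, w\<^sub>0) \<epsilon>) (\<lambda>z. acc (fst z) (snd z))"
proof -
  define H where "H z = (\<Sum>b\<in>Basis. B (D2 (fst z) (snd z) (snd z)) (D1 (fst z) b) *\<^sub>R b)" for z
  define G where "G z = (\<Sum>b\<in>Basis. B (D1 (fst z) (snd z)) (D1 (fst z) b) *\<^sub>R b)" for z
  have lin: "linear (\<lambda>d. B y (D1 x d))" if "x \<in> V" for x y
    using linear_D1[OF that] by (intro linearI) (auto simp: linear_add linear_scale B_simps)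
  have H: "H (x, w) \<bullet> d = B (D2 x w w) (D1 x d)" if "x \<in> V" for x w d
    unfolding H_def using riesz_Basis[OF lin[OF that]] by simp
  have G: "G (x, w) \<bullet> d = B (D1 x w) (D1 x d)" if "x \<in> V" for x w d
    unfolding G_def using riesz_Basis[OF lin[OF that]] by simp
  have smooth_fst: "Ck_on k (\<lambda>z. D1 (fst z) b) (V \<times> (UNIV :: 'a set))" for k b
    by (rule Ck_on_linear_inner[OF bounded_linear_fst open_V open_V_UNIV _ smooth_D1]) auto
  have smooth: "Ck_on k H (V \<times> UNIV)" "Ck_on k G (V \<times> UNIV)" for k
    unfolding H_def [abs_def] G_def [abs_def]
    by (rule Ck_on_sum[OF open_V_UNIV] Ck_on_linear_outer[OF open_V_UNIV bounded_linear_scaleR_left]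
        Ck_on_prod[OF open_V_UNIV] smooth_D2_diagonal smooth_D1_joint smooth_fst)+
  let ?K = "cball (x\<^sub>0, w\<^sub>0) \<epsilon>"
  have K_fst: "fst z \<in> cball x\<^sub>0 \<epsilon>" if "z \<in> ?K" for z
    using that dist_fst_le[of "(x\<^sub>0, w\<^sub>0)" z] by auto
  then have K: "?K \<subseteq> V \<times> UNIV"
    using V by (auto simp: mem_Times_iff)
  obtain C\<^sub>1 where C\<^sub>1: "C\<^sub>1-lipschitz_on ?K H"
    using C1_on_lipschitz_on_compact_convex[OF smooth(1) compact_cball convex_cball K] by metis
  have "compact (H ` ?K)"
    using K by (intro compact_continuous_image continuous_on_subset[OF Ck_on_imp_continuous[OF smooth(1)[of 0]]]) auto
  then have "bounded (H ` ?K)" by (rule compact_imp_bounded)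
  then obtain C\<^sub>0 where C\<^sub>0: "C\<^sub>0 > 0" "\<And>z. z \<in> ?K \<Longrightarrow> norm (H z) \<le> C\<^sub>0"
    unfolding bounded_pos by blast
  obtain \<mu> where \<mu>: "\<mu> > 0" "\<And>x u. x \<in> E \<inter> cball x\<^sub>0 \<epsilon> \<Longrightarrow> u \<in> E \<Longrightarrow> \<mu> * (norm u)\<^sup>2 \<le> B (D1 x u) (D1 x u)"
    using coercive[OF closed_Int_compact[OF closed_subspace[OF sub_E] compact_cball]] V by (metis Int_mono order_refl)
  define R where "R = C\<^sub>0 / \<mu>"
  have "compact (cball x\<^sub>0 \<epsilon> \<times> cball (0::'a) R)" "convex (cball x\<^sub>0 \<epsilon> \<times> cball (0::'a) R)"
    "cball x\<^sub>0 \<epsilon> \<times> cball (0::'a) R \<subseteq> V \<times> UNIV"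
    using V by (auto intro: compact_Times convex_Times)
  then obtain C\<^sub>2 where C\<^sub>2: "C\<^sub>2-lipschitz_on (cball x\<^sub>0 \<epsilon> \<times> cball 0 R) G"
    using C1_on_lipschitz_on_compact_convex[OF smooth(2)] by blast
  have cancel: "norm u \<le> c / \<mu>" if "\<mu> * (norm u)\<^sup>2 \<le> c * norm u" "c \<ge> 0" for u :: 'a and c
  proof (cases "u = 0")
    case False
    then have "\<mu> * norm u \<le> c"
      using that(1) by (simp add: power2_eq_square flip: mult.assoc)
    then show ?thesis using \<mu>(1) by (simp add: field_simps)
  qed (use that \<mu>(1) in auto)
  have small: "norm (acc x w) \<le> R" if "x \<in> E" "(x, w) \<in> ?K" for x w
    unfolding R_def
  proof (rule cancel)
    have x: "x \<in> V" "x \<in> cball x\<^sub>0 \<epsilon>" using K_fst[OF that(2)] V by auto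
    let ?a = "acc x w"
    have a: "?a \<in> E" using acc(1) that(1) x by blast
    have "\<mu> * (norm ?a)\<^sup>2 \<le> B (D1 x ?a) (D1 x ?a)"
      using \<mu>(2) that(1) x a by blast
    also have "\<dots> = - (H (x, w) \<bullet> ?a)"
      using acc(2)[OF that(1) x(1) a] H[OF x(1)] by simp
    also have "\<dots> \<le> norm (H (x, w)) * norm ?a"
      using Cauchy_Schwarz_ineq2[of "H (x, w)" ?a] by linarith
    also have "\<dots> \<le> C\<^sub>0 * norm ?a"
      using C\<^sub>0(2)[OF that(2)] by (intro mult_right_mono) auto
    finally show "\<mu> * (norm ?a)\<^sup>2 \<le> C\<^sub>0 * norm ?a" .
  qed (use C\<^sub>0 in simp)
  have C12: "C\<^sub>1 \<ge> 0" "C\<^sub>2 \<ge> 0"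
    using C\<^sub>1 C\<^sub>2 by (auto dest: lipschitz_on_nonneg)
  have "((C\<^sub>1 + C\<^sub>2) / \<mu>)-lipschitz_on ((E \<times> E) \<inter> ?K) (\<lambda>z. acc (fst z) (snd z))"
  proof (rule lipschitz_onI)
    fix z y assume zy: "z \<in> (E \<times> E) \<inter> ?K" "y \<in> (E \<times> E) \<inter> ?K"
    obtain x w where z: "z = (x, w)" by fastforce
    obtain x' w' where y: "y = (x', w')" by fastforce
    have x: "x \<in> E" "x \<in> cball x\<^sub>0 \<epsilon>" "x \<in> V" "(x, w) \<in> ?K" and x': "x' \<in> E" "x' \<in> cball x\<^sub>0 \<epsilon>" "x' \<in> V" "(x', w') \<in> ?K"
      using zy K_fst[of z] K_fst[of y] V unfolding z y by auto
    define a where "a = acc x w"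
    define a' where "a' = acc x' w'"
    define d where "d = a - a'"
    have aE: "a \<in> E" "a' \<in> E" "d \<in> E"
      using acc(1) x x' subspace_diff[OF sub_E] by (auto simp: a_def a'_def d_def)
    have a'R: "a' \<in> cball 0 R" using small x' unfolding a'_def by simp
    have "\<mu> * (norm d)\<^sup>2 \<le> B (D1 x d) (D1 x d)"
      using \<mu>(2) x aE by blast
    also have "\<dots> = B (D1 x a) (D1 x d) - B (D1 x a') (D1 x d)"
      unfolding d_def using linear_diff[OF linear_D1[OF x(3)], of a a'] by (simp add: B_simps)
    also have "\<dots> = (H y - H z) \<bullet> d + (G (x', a') - G (x, a')) \<bullet> d"
      using acc(2)[OF x(1,3) aE(3), of w] acc(2)[OF x'(1,3) aE(3), of w']
      unfolding a_def[symmetric] a'_def[symmetric] z y inner_diff_left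
        H[OF x(3)] H[OF x'(3)] G[OF x(3)] G[OF x'(3)] by simp
    also have "\<dots> \<le> norm (H y - H z) * norm d + norm (G (x', a') - G (x, a')) * norm d"
      by (intro add_mono norm_cauchy_schwarz)
    also have "\<dots> \<le> (C\<^sub>1 * dist z y) * norm d + (C\<^sub>2 * dist z y) * norm d"
    proof (intro add_mono mult_right_mono norm_ge_zero)
      show "norm (H y - H z) \<le> C\<^sub>1 * dist z y"
        using lipschitz_onD[OF C\<^sub>1, of y z] zy by (simp add: dist_norm norm_minus_commute)
      have "norm (G (x', a') - G (x, a')) \<le> C\<^sub>2 * dist (x', a') (x, a')"
        using lipschitz_onD[OF C\<^sub>2, of "(x', a')" "(x, a')"] x x' a'R by (simp add: dist_norm)
      also have "\<dots> \<le> C\<^sub>2 * dist z y"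
        using C12(2) dist_fst_le[of z y] by (intro mult_left_mono) (simp_all add: z y dist_Pair_Pair dist_commute)
      finally show "norm (G (x', a') - G (x, a')) \<le> C\<^sub>2 * dist z y" .
    qed
    also have "\<dots> = ((C\<^sub>1 + C\<^sub>2) * dist z y) * norm d"
      by (simp add: algebra_simps)
    finally have "norm d \<le> ((C\<^sub>1 + C\<^sub>2) * dist z y) / \<mu>"
      by (rule cancel) (use C12 in simp)
    then show "dist (acc (fst z) (snd z)) (acc (fst y) (snd y)) \<le> (C\<^sub>1 + C\<^sub>2) / \<mu> * dist z y"
      by (simp add: z y dist_norm d_def a_def a'_def)
  qed (use C12 \<mu>(1) in simp)
  then show ?thesis using that by blast
qed

text \<open>Expanding \<open>w\<close> in the standard basis reduces the chain rule for \<open>D1\<close>, jointly in both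
  arguments, to one argument at a time.\<close>

lemma D1_along_curve:
  assumes "(x has_vector_derivative x') (at s within J)" "(w has_vector_derivative w') (at s within J)"
    and s: "s \<in> J" and V: "\<And>s. s \<in> J \<Longrightarrow> x s \<in> V"
  shows "((\<lambda>s. D1 (x s) (w s)) has_vector_derivative D2 (x s) x' (w s) + D1 (x s) w') (at s within J)"
proof -
  have D1b: "((\<lambda>s. D1 (x s) b) has_vector_derivative D2 (x s) x' b) (at s within J)" for b
    using has_derivative_compose[OF assms(1)[unfolded has_vector_derivative_def] D2_derivative[OF V[OF s]]]
      linear_scale[OF linear_D2_left[OF V[OF s]]]
    by (simp add: has_vector_derivative_def)
  have wb: "((\<lambda>s. w s \<bullet> b) has_real_derivative w' \<bullet> b) (at s within J)" for b
    using bounded_linear.has_vector_derivative[OF bounded_linear_inner_left assms(2)]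
    by (simp add: has_real_derivative_iff_has_vector_derivative)
  have "((\<lambda>s. \<Sum>b\<in>Basis. (w s \<bullet> b) *\<^sub>R D1 (x s) b) has_vector_derivative
      (\<Sum>b\<in>Basis. (w s \<bullet> b) *\<^sub>R D2 (x s) x' b + (w' \<bullet> b) *\<^sub>R D1 (x s) b)) (at s within J)"
    by (intro has_vector_derivative_sum has_vector_derivative_scaleR wb D1b)
  moreover have "(\<Sum>b\<in>Basis. (w s \<bullet> b) *\<^sub>R D2 (x s) x' b + (w' \<bullet> b) *\<^sub>R D1 (x s) b)
      = D2 (x s) x' (w s) + D1 (x s) w'"
    using linear_eq_sum_Basis[OF linear_D1[OF V[OF s]], of w'] linear_eq_sum_Basis[OF linear_D2_right[OF V[OF s]], of x' "w s"]
    by (simp add: sum.distrib)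
  ultimately have "((\<lambda>s. \<Sum>b\<in>Basis. (w s \<bullet> b) *\<^sub>R D1 (x s) b) has_vector_derivative
      D2 (x s) x' (w s) + D1 (x s) w') (at s within J)"
    by simp
  then show ?thesis
    by (rule has_vector_derivative_transform[OF s, rotated]) (rule linear_eq_sum_Basis[OF linear_D1[OF V]])
qed

lemma \<Psi>_along_curve:
  assumes "(x has_vector_derivative x') (at s within J)" "x s \<in> V"
  shows "((\<lambda>s. \<Psi> (x s)) has_vector_derivative D1 (x s) x') (at s within J)"
  using has_derivative_compose[OF assms(1)[unfolded has_vector_derivative_def] D1_derivative[OF assms(2)]]
    linear_scale[OF linear_D1[OF assms(2)]]
  by (simp add: has_vector_derivative_def)

text \<open>The geodesic equation as a first-order system for position and velocity in \<open>E \<times> E\<close>. The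
  conclusion records the acceleration at the initial point, which carries the second derivative of \<open>\<Psi>\<close>.\<close>

lemma geodesic_exists:
  assumes x\<^sub>0: "x\<^sub>0 \<in> E" "x\<^sub>0 \<in> V" and w\<^sub>0: "w\<^sub>0 \<in> E"
  obtains \<delta> \<gamma> \<gamma>' a where "\<delta> > 0" "geodesic B S {0..\<delta>} \<gamma>" "\<gamma> 0 = \<Psi> x\<^sub>0" "a \<in> E"
    "\<And>s. s \<in> {0..\<delta>} \<Longrightarrow> (\<gamma> has_vector_derivative \<gamma>' s) (at s within {0..\<delta>})"
    "(\<gamma>' has_vector_derivative D2 x\<^sub>0 w\<^sub>0 w\<^sub>0 + D1 x\<^sub>0 a) (at 0 within {0..\<delta>})"
proof -
  obtain \<epsilon> where \<epsilon>: "\<epsilon> > 0" "cball x\<^sub>0 \<epsilon> \<subseteq> V"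
    using open_V x\<^sub>0(2) open_contains_cball by blast
  obtain acc where acc: "\<And>x w. x \<in> E \<Longrightarrow> x \<in> V \<Longrightarrow> acc x w \<in> E"
      "\<And>x w e. x \<in> E \<Longrightarrow> x \<in> V \<Longrightarrow> e \<in> E \<Longrightarrow> B (D1 x (acc x w)) (D1 x e) = - B (D2 x w w) (D1 x e)"
    using acceleration_exists by metis
  let ?K = "(E \<times> E) \<inter> cball (x\<^sub>0, w\<^sub>0) \<epsilon>"
  obtain L where L: "L-lipschitz_on ?K (\<lambda>z. acc (fst z) (snd z))"
    using acceleration_lipschitz[OF \<epsilon> acc] by blast
  have K_V: "fst z \<in> V" "fst z \<in> E" "snd z \<in> E" if "z \<in> ?K" for z
    using that dist_fst_le[of "(x\<^sub>0, w\<^sub>0)" z] \<epsilon>(2) by (auto simp: mem_Times_iff subset_iff)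
  have snd_lip: "1-lipschitz_on ?K snd"
    using dist_snd_le by (intro lipschitz_onI) auto
  have z\<^sub>0: "(x\<^sub>0, w\<^sub>0) \<in> E \<times> E"
    using x\<^sub>0 w\<^sub>0 by simp
  have field: "(snd z, acc (fst z) (snd z)) \<in> E \<times> E" if "z \<in> ?K" for z
    using K_V[OF that] acc(1) by simp
  note lip = lipschitz_on_Pair[OF snd_lip L]
  obtain \<delta> z where \<delta>: "\<delta> > 0" and z0: "z 0 = (x\<^sub>0, w\<^sub>0)" and zK: "\<And>t. t \<in> {0..\<delta>} \<Longrightarrow> z t \<in> ?K"
    and dz: "\<And>t. t \<in> {0..\<delta>} \<Longrightarrow> (z has_vector_derivative (snd (z t), acc (fst (z t)) (snd (z t)))) (at t within {0..\<delta>})"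
    using picard_lindelof[OF subspace_Times[OF sub_E sub_E] z\<^sub>0 \<epsilon>(1) lip field] by blast
  define x where "x t = fst (z t)" for t
  define w where "w t = snd (z t)" for t
  have x: "x t \<in> V" "x t \<in> E" "w t \<in> E" if "t \<in> {0..\<delta>}" for t
    using K_V[OF zK[OF that]] by (auto simp: x_def w_def)
  have dx: "(x has_vector_derivative w t) (at t within {0..\<delta>})" if "t \<in> {0..\<delta>}" for t
    using bounded_linear.has_vector_derivative[OF bounded_linear_fst dz[OF that]] by (simp add: x_def [abs_def] w_def)
  have dw: "(w has_vector_derivative acc (x t) (w t)) (at t within {0..\<delta>})" if "t \<in> {0..\<delta>}" for t
    using bounded_linear.has_vector_derivative[OF bounded_linear_snd dz[OF that]] by (simp add: x_def w_def [abs_def])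
  define \<gamma> where "\<gamma> t = \<Psi> (x t)" for t
  define \<gamma>' where "\<gamma>' t = D1 (x t) (w t)" for t
  define \<gamma>'' where "\<gamma>'' t = D2 (x t) (w t) (w t) + D1 (x t) (acc (x t) (w t))" for t
  have d\<gamma>: "(\<gamma> has_vector_derivative \<gamma>' t) (at t within {0..\<delta>})" if "t \<in> {0..\<delta>}" for t
    unfolding \<gamma>_def [abs_def] \<gamma>'_def by (rule \<Psi>_along_curve[OF dx[OF that] x(1)[OF that]])
  have d\<gamma>': "(\<gamma>' has_vector_derivative \<gamma>'' t) (at t within {0..\<delta>})" if "t \<in> {0..\<delta>}" for t
    unfolding \<gamma>'_def [abs_def] \<gamma>''_def by (rule D1_along_curve[OF dx[OF that] dw[OF that] that x(1)])
  have z_cont: "continuous_on {0..\<delta>} z"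
    using dz has_vector_derivative_continuous continuous_on_eq_continuous_within by blast
  have "continuous_on {0..\<delta>} (\<lambda>t. acc (fst (z t)) (snd (z t)))"
    by (rule continuous_on_compose2[OF lipschitz_on_continuous_on[OF L] z_cont]) (use zK in blast)
  then have "continuous_on {0..\<delta>} (\<lambda>t. (fst (z t), acc (fst (z t)) (snd (z t))))"
    by (intro continuous_on_Pair continuous_on_fst z_cont)
  then have "continuous_on {0..\<delta>} (\<lambda>t. D1 (x t) (acc (x t) (w t)))"
    using continuous_on_compose2[OF Ck_on_imp_continuous[OF smooth_D1_joint[of 0]]] x(1)
    by (fastforce simp: x_def w_def)
  moreover have "continuous_on {0..\<delta>} (\<lambda>t. D2 (x t) (w t) (w t))"
    unfolding x_def w_def
    by (rule continuous_on_compose2[OF Ck_on_imp_continuous[OF smooth_D2_diagonal[of 0]] z_cont])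
      (use x(1) in \<open>auto simp: x_def mem_Times_iff image_subset_iff\<close>)
  ultimately have "continuous_on {0..\<delta>} \<gamma>''"
    unfolding \<gamma>''_def [abs_def] by (intro continuous_on_add)
  then have "C2_curve {0..\<delta>} \<gamma>"
    unfolding C2_curve_def using d\<gamma> d\<gamma>' by blast
  moreover have "parameter_interval {0..\<delta>}"
    using \<delta> by (auto simp: parameter_interval_def is_interval_cc)
  moreover have "\<gamma> ` {0..\<delta>} \<subseteq> S"
    using \<Psi>_S x by (auto simp: \<gamma>_def)
  moreover have "has_covariant_derivative B S {0..\<delta>} \<gamma> \<gamma>' 0 t" if t: "t \<in> {0..\<delta>}" for t
  proof -
    have tan: "tangent_space S (\<gamma> t) = D1 (x t) ` E"
      unfolding \<gamma>_def by (rule tangent_space_chart[OF x(2,1)[OF t]])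
    have "0 \<in> D1 (x t) ` E"
      using linear_0[OF linear_D1[OF x(1)[OF t]]] subspace_0[OF sub_E] by (metis image_eqI)
    moreover have "B (\<gamma>'' t - 0) u = 0" if "u \<in> D1 (x t) ` E" for u
      using that acc(2)[OF x(2)[OF t] x(1)[OF t]] by (auto simp: \<gamma>''_def add_left)
    ultimately show ?thesis
      unfolding has_covariant_derivative_def tan using d\<gamma>'[OF t] by blast
  qed
  ultimately have "geodesic B S {0..\<delta>} \<gamma>"
    unfolding geodesic_def using d\<gamma> by blast
  moreover have "(\<gamma>' has_vector_derivative D2 x\<^sub>0 w\<^sub>0 w\<^sub>0 + D1 x\<^sub>0 (acc x\<^sub>0 w\<^sub>0)) (at 0 within {0..\<delta>})"
    using d\<gamma>'[of 0] \<delta> z0 by (simp add: \<gamma>''_def x_def w_def)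
  moreover have "\<gamma> 0 = \<Psi> x\<^sub>0" using z0 by (simp add: \<gamma>_def x_def)
  ultimately show ?thesis
    using that[of \<delta> \<gamma> "acc x\<^sub>0 w\<^sub>0" \<gamma>'] \<delta> d\<gamma> acc(1)[OF x\<^sub>0] by blast
qed

end

section \<open>Totally geodesic submanifolds\<close>

context submanifold_chart
begin

text \<open>The span of the point \<open>p = \<Psi> x\<close> and of the tangent space of \<open>S\<close> at \<open>p\<close>. If \<open>S\<close> is
  the intersection of \<open>M\<close> with a linear subspace, this is that subspace.\<close>

definition osc where "osc x = {D1 x a + c *\<^sub>R \<Psi> x |a c. a \<in> E}"

lemma osc_eq_span:
  assumes "x \<in> V" shows "osc x = span (insert (\<Psi> x) (D1 x ` E))"
proof -
  have span_image: "span (D1 x ` E) = D1 x ` E"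
    using linear_subspace_image[OF linear_D1[OF assms] sub_E] by simp
  have "span (insert (\<Psi> x) (D1 x ` E)) = {v. \<exists>c. v - c *\<^sub>R \<Psi> x \<in> D1 x ` E}"
    unfolding span_insert span_image ..
  also have "\<dots> = osc x"
  proof safe
    fix v c a assume "v - c *\<^sub>R \<Psi> x = D1 x a" "a \<in> E"
    then have "v = D1 x a + c *\<^sub>R \<Psi> x" by (simp add: algebra_simps)
    with \<open>a \<in> E\<close> show "v \<in> osc x" unfolding osc_def by blast
  next
    fix v assume "v \<in> osc x"
    then obtain a c where "a \<in> E" "v = D1 x a + c *\<^sub>R \<Psi> x" unfolding osc_def by blast
    then show "\<exists>c. v - c *\<^sub>R \<Psi> x \<in> D1 x ` E" by (intro exI[of _ c]) auto
  qed
  finally show ?thesis by simp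
qed

lemma subspace_osc: "x \<in> V \<Longrightarrow> subspace (osc x)"
  by (simp add: osc_eq_span)

lemma D1_in_osc: "a \<in> E \<Longrightarrow> D1 x a \<in> osc x"
  unfolding osc_def by (rule CollectI, rule exI[of _ a], rule exI[of _ 0]) simp

lemma \<Psi>_in_osc: "x \<in> V \<Longrightarrow> \<Psi> x \<in> osc x"
  by (simp add: osc_eq_span span_base)

text \<open>The geodesic of \<open>S\<close> with initial velocity \<open>D1 x w\<close> has acceleration \<open>D2 x w w + D1 x a\<close>. As it
  is a geodesic of \<open>M\<close>, this acceleration is a multiple of the point.\<close>

lemma D2_diagonal_in_osc:
  assumes tg: "\<And>J \<gamma>. geodesic B S J \<gamma> \<Longrightarrow> geodesic B M J \<gamma>"
    and x: "x \<in> E" "x \<in> V" and w: "w \<in> E"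
  shows "D2 x w w \<in> osc x"
proof -
  obtain \<delta> \<gamma> \<gamma>' a where \<delta>: "\<delta> > 0" and geo: "geodesic B S {0..\<delta>} \<gamma>" and \<gamma>0: "\<gamma> 0 = \<Psi> x" and a: "a \<in> E"
    and d\<gamma>: "\<And>s. s \<in> {0..\<delta>} \<Longrightarrow> (\<gamma> has_vector_derivative \<gamma>' s) (at s within {0..\<delta>})"
    and d\<gamma>': "(\<gamma>' has_vector_derivative D2 x w w + D1 x a) (at 0 within {0..\<delta>})"
    by (rule geodesic_exists[OF x w], rule that)
  have J: "parameter_interval {0..\<delta>}" using geo unfolding geodesic_def by blast
  have zero: "0 \<in> {0..\<delta>}" using \<delta> by simp
  have \<Psi>M: "\<Psi> x \<in> M" using \<Psi>_S[OF x] S_M by blast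
  obtain \<eta> where d\<eta>: "\<And>s. s \<in> {0..\<delta>} \<Longrightarrow> (\<gamma> has_vector_derivative \<eta> s) (at s within {0..\<delta>})"
    and cov: "has_covariant_derivative B M {0..\<delta>} \<gamma> \<eta> 0 0"
    using tg[OF geo] zero unfolding geodesic_def by blast
  have eq: "\<eta> s = \<gamma>' s" if "s \<in> {0..\<delta>}" for s
    using vector_derivative_unique_within[OF parameter_interval_nontrivial[OF J that] d\<eta>[OF that] d\<gamma>[OF that]] .
  obtain D where D: "(\<eta> has_vector_derivative D) (at 0 within {0..\<delta>})"
    and orth: "\<And>u. B u (\<Psi> x) = 0 \<Longrightarrow> B D u = 0"
    using cov unfolding has_covariant_derivative_def \<gamma>0 tangent_space_eq[OF \<Psi>M] by auto
  have "(\<gamma>' has_vector_derivative D) (at 0 within {0..\<delta>})"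
    by (rule has_vector_derivative_transform[OF zero _ D]) (simp add: eq)
  then have "D = D2 x w w + D1 x a"
    using vector_derivative_unique_within[OF parameter_interval_nontrivial[OF J zero] _ d\<gamma>'] by blast
  moreover have "D = (B D (\<Psi> x) / \<beta>) *\<^sub>R \<Psi> x"
    by (rule normal_direction[OF \<Psi>M orth])
  ultimately have "D2 x w w = (B D (\<Psi> x) / \<beta>) *\<^sub>R \<Psi> x - D1 x a"
    by (metis add_diff_cancel)
  also have "\<dots> \<in> osc x"
    by (intro subspace_diff subspace_scale subspace_osc \<Psi>_in_osc D1_in_osc x a)
  finally show ?thesis .
qed

text \<open>Polarization; the symmetry of the second derivative is essential here.\<close>

lemma D2_in_osc:
  assumes tg: "\<And>J \<gamma>. geodesic B S J \<gamma> \<Longrightarrow> geodesic B M J \<gamma>"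
    and x: "x \<in> E" "x \<in> V" and v: "v \<in> E" and w: "w \<in> E"
  shows "D2 x v w \<in> osc x"
proof -
  have "D2 x (v + w) (v + w) = D2 x v v + D2 x w w + (D2 x v w + D2 x w v)"
    by (simp add: linear_add[OF linear_D2_left[OF x(2)]] linear_add[OF linear_D2_right[OF x(2)]])
  then have "2 *\<^sub>R D2 x v w = D2 x (v + w) (v + w) - D2 x v v - D2 x w w"
    using D2_symmetric[OF x(2), of w v] by (simp add: scaleR_2)
  then have "D2 x v w = (1 / 2) *\<^sub>R (D2 x (v + w) (v + w) - D2 x v v - D2 x w w)"
    by (metis divide_self_if one_neq_zero scaleR_one scaleR_scaleR times_divide_eq_left mult_1 zero_neq_numeral)
  also have "\<dots> \<in> osc x"
    using D2_diagonal_in_osc[OF tg x] subspace_add[OF sub_E v w] v w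
    by (intro subspace_diff subspace_scale subspace_osc x) auto
  finally show ?thesis .
qed

text \<open>The vector \<open>Y = (\<Sum>b\<in>T. B N (D1 x b) b, B N (\<Psi> x))\<close> collects the components of \<open>N\<close> along
  \<open>osc x\<close>: for \<open>q = D1 x a + c \<Psi> x\<close>, the value \<open>B N q\<close> is the inner product of \<open>Y\<close> and \<open>(a, c)\<close>. So
  it suffices to bound the coefficients \<open>a\<close> and \<open>c\<close> of \<open>F x\<close> over the compact set: \<open>c\<close> is read off by
  pairing with the point, which is orthogonal to the tangent space, and \<open>a\<close> is controlled by coercivity.\<close>

lemma osc_form_bound:
  assumes K: "compact K" "K \<subseteq> E \<inter> V"
    and T: "T \<subseteq> E" "\<And>(f :: 'a \<Rightarrow> real) u. linear f \<Longrightarrow> u \<in> E \<Longrightarrow> (\<Sum>b\<in>T. f b *\<^sub>R b) \<bullet> u = f u"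
    and F: "continuous_on K F" "\<And>x. x \<in> K \<Longrightarrow> F x \<in> osc x"
  shows "\<exists>C. \<forall>x\<in>K. \<forall>N. \<bar>B N (F x)\<bar> \<le> C * norm ((\<Sum>b\<in>T. B N (D1 x b) *\<^sub>R b), B N (\<Psi> x))"
proof -
  define H where "H x = (\<Sum>b\<in>Basis. B (F x) (D1 x b) *\<^sub>R b)" for x
  have lin: "linear (\<lambda>d. B y (D1 x d))" if "x \<in> V" for x y
    using linear_D1[OF that] by (intro linearI) (auto simp: linear_add linear_scale B_simps)
  have H: "H x \<bullet> d = B (F x) (D1 x d)" if "x \<in> V" for x d
    unfolding H_def using riesz_Basis[OF lin[OF that]] by simp
  have cont_D1: "continuous_on K (\<lambda>x. D1 x b)" for b
    using K(2) by (intro continuous_on_subset[OF Ck_on_imp_continuous[OF smooth_D1[of 0]]]) auto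
  have cont_\<Psi>: "continuous_on K \<Psi>"
    using K(2) by (intro continuous_on_subset[OF Ck_on_imp_continuous[OF smooth_\<Psi>[of 0]]]) auto
  have "continuous_on K H"
    unfolding H_def [abs_def] by (intro continuous_on_sum continuous_on_scaleR continuous_on continuous_on_const F(1) cont_D1)
  then have "bounded (H ` K)"
    using K(1) compact_continuous_image compact_imp_bounded by blast
  then obtain h where h: "h > 0" "\<And>x. x \<in> K \<Longrightarrow> norm (H x) \<le> h"
    unfolding bounded_pos by blast
  have "continuous_on K (\<lambda>x. B (F x) (\<Psi> x))"
    by (intro continuous_on F(1) cont_\<Psi>)
  then have "bounded ((\<lambda>x. B (F x) (\<Psi> x)) ` K)"
    using K(1) compact_continuous_image compact_imp_bounded by blast
  then obtain p where p: "p > 0" "\<And>x. x \<in> K \<Longrightarrow> norm (B (F x) (\<Psi> x)) \<le> p"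
    unfolding bounded_pos by blast
  obtain \<mu> where \<mu>: "\<mu> > 0" "\<And>x u. x \<in> K \<Longrightarrow> u \<in> E \<Longrightarrow> \<mu> * (norm u)\<^sup>2 \<le> B (D1 x u) (D1 x u)"
    using coercive[OF K] by blast
  show ?thesis
  proof (intro exI ballI allI)
    fix x N assume xK: "x \<in> K"
    then have x: "x \<in> E" "x \<in> V" using K(2) by auto
    obtain a c where a: "a \<in> E" and Fx: "F x = D1 x a + c *\<^sub>R \<Psi> x"
      using F(2)[OF xK] unfolding osc_def by blast
    have \<Psi>M: "\<Psi> x \<in> M" using \<Psi>_S[OF x] S_M by blast
    have orth: "B (D1 x a) (\<Psi> x) = 0" "B (\<Psi> x) (D1 x a) = 0"
      using tangent_orthogonal[OF x a] sym by auto
    have "B (F x) (\<Psi> x) = c * \<beta>"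
      unfolding Fx using orth on_quadric[OF \<Psi>M] by (simp add: B_simps)
    then have c: "\<bar>c\<bar> \<le> p / \<bar>\<beta>\<bar>"
      using p(2)[OF xK] \<beta>_nonzero by (simp add: abs_mult field_simps)
    have "\<mu> * (norm a)\<^sup>2 \<le> B (D1 x a) (D1 x a)" using \<mu>(2)[OF xK a] .
    also have "\<dots> = H x \<bullet> a"
      unfolding H[OF x(2)] Fx using orth by (simp add: B_simps)
    also have "\<dots> \<le> h * norm a"
      using norm_cauchy_schwarz[of "H x" a] mult_right_mono[OF h(2)[OF xK], of "norm a"] by simp
    finally have na: "norm a \<le> h / \<mu>"
    proof (cases "a = 0")
      case False
      assume "\<mu> * (norm a)\<^sup>2 \<le> h * norm a"
      with False have "\<mu> * norm a \<le> h" by (simp add: power2_eq_square flip: mult.assoc)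
      then show ?thesis using \<mu>(1) by (simp add: field_simps)
    qed (use h \<mu> in auto)
    define Y where "Y = ((\<Sum>b\<in>T. B N (D1 x b) *\<^sub>R b), B N (\<Psi> x))"
    have "B N (F x) = fst Y \<bullet> a + c * snd Y"
      unfolding Fx Y_def using T(2)[OF lin[OF x(2)] a] by (simp add: B_simps)
    then have "\<bar>B N (F x)\<bar> \<le> \<bar>fst Y \<bullet> a\<bar> + \<bar>c\<bar> * \<bar>snd Y\<bar>"
      by (metis abs_mult abs_triangle_ineq)
    also have "\<dots> \<le> norm (fst Y) * norm a + \<bar>c\<bar> * norm (snd Y)"
      using Cauchy_Schwarz_ineq2[of "fst Y" a] by simp
    also have "\<dots> \<le> norm Y * (h / \<mu>) + (p / \<bar>\<beta>\<bar>) * norm Y"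
      using norm_fst_le[of "fst Y" "snd Y"] norm_snd_le[of "snd Y" "fst Y"] na c h(1) p(1) \<mu>(1)
      by (intro add_mono mult_mono) auto
    finally show "\<bar>B N (F x)\<bar> \<le> (h / \<mu> + p / \<bar>\<beta>\<bar>) * norm ((\<Sum>b\<in>T. B N (D1 x b) *\<^sub>R b), B N (\<Psi> x))"
      unfolding Y_def[symmetric] by (simp add: algebra_simps)
  qed
qed

text \<open>Along the segment from \<open>x\<close> to \<open>y\<close>, the components \<open>Y\<close> of \<open>N\<close> along \<open>osc\<close> have derivative
  \<open>Z\<close>, formed with \<open>D2\<close> and \<open>D1\<close> in the direction \<open>d\<close> of the segment. These vectors lie again in
  \<open>osc\<close>, so \<open>Z\<close> is bounded by a multiple of \<open>Y\<close>, and \<open>Y\<close> vanishes everywhere if it vanishes at \<open>x\<close>.\<close>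

lemma osc_orthogonal_propagates:
  assumes tg: "\<And>J \<gamma>. geodesic B S J \<gamma> \<Longrightarrow> geodesic B M J \<gamma>"
    and K: "compact K" "convex K" "K \<subseteq> E \<inter> V" and x: "x \<in> K" and y: "y \<in> K"
    and N: "\<And>q. q \<in> osc x \<Longrightarrow> B N q = 0" and q: "q \<in> osc y"
  shows "B N q = 0"
proof -
  obtain T where T: "finite T" "T \<subseteq> E"
    and riesz: "\<And>(f :: 'a \<Rightarrow> real) u. linear f \<Longrightarrow> u \<in> E \<Longrightarrow> (\<Sum>b\<in>T. f b *\<^sub>R b) \<bullet> u = f u"
    using subspace_riesz[OF sub_E] by metis
  define d where "d = y - x"
  have dE: "d \<in> E" using x y K(3) subspace_diff[OF sub_E] by (auto simp: d_def)
  define Y where "Y z = ((\<Sum>b\<in>T. B N (D1 z b) *\<^sub>R b), B N (\<Psi> z))" for z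
  define Z where "Z z = ((\<Sum>b\<in>T. B N (D2 z d b) *\<^sub>R b), B N (D1 z d))" for z
  have cont: "continuous_on K (\<lambda>z. D2 z d b)" "continuous_on K (\<lambda>z. D1 z d)" for b
    using K(3) by (auto intro!: continuous_on_subset[OF Ck_on_imp_continuous[OF smooth_D1[of 0]]]
        continuous_on_subset[OF Ck_on_imp_continuous[OF smooth_D2[of 0]]])
  have "\<exists>C. \<forall>z\<in>K. \<bar>B N (D2 z d b)\<bar> \<le> C * norm (Y z)" if "b \<in> T" for b
  proof -
    have "D2 z d b \<in> osc z" if "z \<in> K" for z
      using D2_in_osc[OF tg _ _ dE] T(2) \<open>b \<in> T\<close> that K(3) by blast
    then show ?thesis
      unfolding Y_def using osc_form_bound[OF K(1,3) T(2) riesz cont(1)] by blast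
  qed
  then obtain C where C: "\<And>b z. b \<in> T \<Longrightarrow> z \<in> K \<Longrightarrow> \<bar>B N (D2 z d b)\<bar> \<le> C b * norm (Y z)"
    by metis
  have "D1 z d \<in> osc z" for z by (rule D1_in_osc[OF dE])
  then obtain C\<^sub>0 where C\<^sub>0: "\<And>z. z \<in> K \<Longrightarrow> \<bar>B N (D1 z d)\<bar> \<le> C\<^sub>0 * norm (Y z)"
    unfolding Y_def using osc_form_bound[OF K(1,3) T(2) riesz cont(2)] by blast
  have Z_bound: "norm (Z z) \<le> ((\<Sum>b\<in>T. C b * norm b) + C\<^sub>0) * norm (Y z)" if "z \<in> K" for z
  proof -
    have "norm (Z z) \<le> norm (\<Sum>b\<in>T. B N (D2 z d b) *\<^sub>R b) + norm (B N (D1 z d))"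
      unfolding Z_def by (rule norm_Pair_le)
    also have "\<dots> \<le> (\<Sum>b\<in>T. \<bar>B N (D2 z d b)\<bar> * norm b) + \<bar>B N (D1 z d)\<bar>"
      by (intro add_mono order.trans[OF norm_sum]) auto
    also have "\<dots> \<le> (\<Sum>b\<in>T. (C b * norm (Y z)) * norm b) + C\<^sub>0 * norm (Y z)"
      using C C\<^sub>0 that by (intro add_mono sum_mono mult_right_mono) auto
    also have "\<dots> = ((\<Sum>b\<in>T. C b * norm b) + C\<^sub>0) * norm (Y z)"
      by (simp add: sum_distrib_right distrib_right mult.assoc mult.commute[of "norm (Y z)"])
    finally show ?thesis .
  qed
  define z where "z s = x + s *\<^sub>R d" for s :: real
  have zK: "z s \<in> K" if "s \<in> {0..1}" for s
  proof -
    have "z s = (1 - s) *\<^sub>R x + s *\<^sub>R y" by (simp add: z_def d_def algebra_simps)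
    then show ?thesis using convexD_alt[OF K(2) x y, of s] that by simp
  qed
  have dz: "(z has_vector_derivative d) (at s within {0..1})" for s
    unfolding z_def [abs_def] by (auto intro!: derivative_eq_intros)
  have "Y (z 1) = 0"
  proof (rule gronwall_zero)
    fix s :: real assume s: "s \<in> {0..1}"
    have V: "z s \<in> V" if "s \<in> {0..1}" for s using zK[OF that] K(3) by blast
    have "((\<lambda>s. D1 (z s) b) has_vector_derivative D2 (z s) d b + D1 (z s) 0) (at s within {0..1})" for b
      by (rule D1_along_curve[OF dz _ s V]) auto
    then have "((\<lambda>s. D1 (z s) b) has_vector_derivative D2 (z s) d b) (at s within {0..1})" for b
      using linear_0[OF linear_D1[OF V[OF s]]] by simp
    then have "((\<lambda>s. Y (z s)) has_vector_derivative Z (z s)) (at s within {0..1})"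
      unfolding Y_def Z_def
      by (intro has_vector_derivative_Pair has_vector_derivative_sum bounded_linear.has_vector_derivative[OF bounded_linear_scaleR_left]
         bounded_linear.has_vector_derivative[OF bounded_linear_right] \<Psi>_along_curve[OF dz V[OF s]])
    then show "((\<lambda>s. Y (z s)) has_vector_derivative Z (z s)) (at s within {0..1})" .
    show "norm (Z (z s)) \<le> ((\<Sum>b\<in>T. C b * norm b) + C\<^sub>0) * norm (Y (z s))"
      by (rule Z_bound[OF zK[OF s]])
  next
    have "\<Psi> x \<in> osc x" "\<And>b. b \<in> T \<Longrightarrow> D1 x b \<in> osc x"
      using \<Psi>_in_osc D1_in_osc x K(3) T(2) by auto
    then have "(\<Sum>b\<in>T. B N (D1 x b) *\<^sub>R b) = 0" "B N (\<Psi> x) = 0"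
      using N by (auto intro!: sum.neutral)
    then show "Y (z 0) = 0" by (simp add: Y_def z_def zero_prod_def)
  qed
  then have Yy: "(\<Sum>b\<in>T. B N (D1 y b) *\<^sub>R b) = 0" "B N (\<Psi> y) = 0"
    by (simp_all add: Y_def z_def d_def zero_prod_def)
  obtain a c where a: "a \<in> E" "q = D1 y a + c *\<^sub>R \<Psi> y"
    using q unfolding osc_def by blast
  have "linear (\<lambda>d. B N (D1 y d))"
    using linear_D1[of y] y K(3) by (intro linearI) (auto simp: linear_add linear_scale B_simps)
  from riesz[OF this a(1)] Yy show ?thesis
    by (simp add: a(2) B_simps)
qed

lemma osc_tangent:
  assumes "x \<in> E" "x \<in> V"
  shows "osc x = span (insert (\<Psi> x) (tangent_space S (\<Psi> x)))"
  using osc_eq_span tangent_space_chart assms by simp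

end

context space_form
begin

lemma chart_at:
  assumes "S \<subseteq> M" "submanifold k S" "p \<in> S"
  obtains U V E \<Phi> \<Psi> where "submanifold_chart B M \<Omega> \<beta> S U V E \<Phi> \<Psi>" "p \<in> U" "dim E = k"
proof -
  obtain U V \<Phi> E where *: "p \<in> U" "diffeomorphism_between U V (\<Phi> :: 'a \<Rightarrow> 'a)" "subspace E" "dim E = k" "\<Phi> ` (S \<inter> U) = E \<inter> V"
    using assms(2,3) unfolding submanifold_def by blast
  then obtain \<Psi> where "homeomorphism U V \<Phi> \<Psi>" "smooth_map_on \<Psi> V"
    unfolding diffeomorphism_between_def by blast
  with * assms(1) have "submanifold_chart B M \<Omega> \<beta> S U V E \<Phi> \<Psi>"
    by unfold_locales (auto simp: diffeomorphism_between_def smooth_map_on_def)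
  with * show ?thesis using that by blast
qed

text \<open>The chart-free form of \<open>osc\<close>, needed to compare points that lie in different charts.\<close>

definition osculating :: "'a set \<Rightarrow> 'a \<Rightarrow> 'a set" where
  "osculating S p = span (insert p (tangent_space S p))"

lemma osculating_orthogonal_locally_constant:
  assumes tg: "totally_geodesic_submanifold B M k S" and p: "p \<in> S"
  obtains W where "open W" "p \<in> W"
    "\<And>x y N. x \<in> S \<inter> W \<Longrightarrow> y \<in> S \<inter> W \<Longrightarrow> (\<forall>q\<in>osculating S x. B N q = 0) \<Longrightarrow> (\<forall>q\<in>osculating S y. B N q = 0)"
proof -
  have S: "S \<subseteq> M" "submanifold k S" and geo: "\<And>J \<gamma>. geodesic B S J \<gamma> \<Longrightarrow> geodesic B M J \<gamma>"
    using tg unfolding totally_geodesic_submanifold_def by auto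
  obtain U V E \<Phi> \<Psi> where chart: "submanifold_chart B M \<Omega> \<beta> S U V E \<Phi> \<Psi>" and pU: "p \<in> U"
    using chart_at[OF S p] by metis
  interpret submanifold_chart B M \<Omega> \<beta> S U V E \<Phi> \<Psi> by fact
  obtain \<epsilon> where \<epsilon>: "\<epsilon> > 0" "cball (\<Phi> p) \<epsilon> \<subseteq> V"
    using open_V \<Phi>_V[OF pU] open_contains_cball by blast
  define K where "K = E \<inter> cball (\<Phi> p) \<epsilon>"
  have K: "compact K" "convex K" "K \<subseteq> E \<inter> V"
    using closed_Int_compact[OF closed_subspace[OF sub_E] compact_cball] \<epsilon>(2) subspace_imp_convex[OF sub_E]
    by (auto simp: K_def intro: convex_Int)
  define W where "W = U \<inter> \<Phi> -` ball (\<Phi> p) \<epsilon>"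
  have "open W"
    unfolding W_def
    using continuous_open_preimage[OF Ck_on_imp_continuous[OF smooth_\<Phi>[of 0]] open_U open_ball] .
  moreover have "p \<in> W" using pU \<epsilon>(1) by (simp add: W_def)
  moreover have "\<forall>q\<in>osculating S y. B N q = 0"
    if x: "x \<in> S \<inter> W" and y: "y \<in> S \<inter> W" and N: "\<forall>q\<in>osculating S x. B N q = 0" for x y N
  proof -
    have osc: "\<Phi> z \<in> K \<and> osc (\<Phi> z) = osculating S z" if "z \<in> S \<inter> W" for z
    proof -
      have z: "z \<in> S" "z \<in> U" "\<Phi> z \<in> K"
        using that \<Phi>_E by (auto simp: W_def K_def)
      then have "\<Phi> z \<in> E" "\<Phi> z \<in> V" using K(3) by auto
      with z show ?thesis using osc_tangent[of "\<Phi> z"] \<Psi>\<Phi>[of z] by (simp add: osculating_def)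
    qed
    show ?thesis
      using osc_orthogonal_propagates[OF geo K, of "\<Phi> x" "\<Phi> y" N] osc[OF x] osc[OF y] N by auto
  qed
  ultimately show ?thesis using that by blast
qed

text \<open>Orthogonality of a fixed vector to the osculating space is an open and closed condition along
  the connected parameter interval, by the local result; a vector that satisfies it at one parameter
  exists for reasons of dimension.\<close>

lemma totally_geodesic_curve_in_hyperplane:
  assumes tg: "totally_geodesic_submanifold B M k S" and k: "k + 1 < DIM('a)"
    and I: "parameter_interval I" and \<alpha>: "continuous_on I \<alpha>" "\<alpha> ` I \<subseteq> S"
  obtains N where "N \<noteq> 0" "\<And>s. s \<in> I \<Longrightarrow> B N (\<alpha> s) = 0"
proof -
  have S: "S \<subseteq> M" "submanifold k S"
    using tg unfolding totally_geodesic_submanifold_def by auto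
  obtain s\<^sub>0 where s\<^sub>0: "s\<^sub>0 \<in> I"
    using I interior_subset by (fastforce simp: parameter_interval_def)
  then have p: "\<alpha> s\<^sub>0 \<in> S" using \<alpha>(2) by blast
  obtain U V E \<Phi> \<Psi> where chart: "submanifold_chart B M \<Omega> \<beta> S U V E \<Phi> \<Psi>" and pU: "\<alpha> s\<^sub>0 \<in> U" and dimE: "dim E = k"
    using chart_at[OF S p] by metis
  interpret submanifold_chart B M \<Omega> \<beta> S U V E \<Phi> \<Psi> by fact
  let ?x = "\<Phi> (\<alpha> s\<^sub>0)"
  have x: "?x \<in> E" "?x \<in> V" and \<Psi>x: "\<Psi> ?x = \<alpha> s\<^sub>0"
    using \<Phi>_E \<Phi>_V \<Psi>\<Phi> p pU by auto
  have "dim (osculating S (\<alpha> s\<^sub>0)) \<le> dim (D1 ?x ` E) + 1"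
    unfolding osculating_def using tangent_space_chart[OF x] by (simp add: \<Psi>x dim_insert)
  also have "\<dots> \<le> k + 1"
    using dim_image_le[OF linear_D1[OF x(2)], of E] dimE by simp
  finally have dim: "dim (osculating S (\<alpha> s\<^sub>0)) \<le> k + 1" .
  \<comment> \<open>\<open>J\<close> represents \<open>B\<close> by the inner product, for which orthogonal vectors are available.\<close>
  define J where "J q = (\<Sum>b\<in>Basis. B b q *\<^sub>R b)" for q
  have J: "J q \<bullet> v = B v q" for q v
    unfolding J_def using riesz_Basis[OF bounded_linear.linear[OF bounded_linear_left]] .
  have "linear J"
    unfolding J_def [abs_def] by (intro linearI) (auto simp: B_simps algebra_simps sum.distrib scaleR_sum_right)
  then have "dim (J ` osculating S (\<alpha> s\<^sub>0)) < DIM('a)"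
    using dim_image_le[of J "osculating S (\<alpha> s\<^sub>0)"] dim k by linarith
  then obtain N where N: "N \<noteq> 0" "\<And>q. q \<in> span (J ` osculating S (\<alpha> s\<^sub>0)) \<Longrightarrow> orthogonal N q"
    using orthogonal_to_subspace_exists by blast
  have N0: "\<forall>q\<in>osculating S (\<alpha> s\<^sub>0). B N q = 0"
  proof
    fix q assume "q \<in> osculating S (\<alpha> s\<^sub>0)"
    then have "orthogonal N (J q)" using N(2) span_base by blast
    then show "B N q = 0" using J[of q N] by (simp add: orthogonal_def inner_commute)
  qed
  have "\<forall>q\<in>osculating S (\<alpha> s). B N q = 0" if s: "s \<in> I" for s
  proof (rule connected_induction_simple[where P="\<lambda>s. \<forall>q\<in>osculating S (\<alpha> s). B N q = 0", OF _ s\<^sub>0 s N0])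
    show "connected I" using I by (simp add: parameter_interval_def is_interval_connected)
    fix a assume a: "a \<in> I"
    then have "\<alpha> a \<in> S" using \<alpha>(2) by blast
    then obtain W where W: "open W" "\<alpha> a \<in> W"
      "\<And>x y N. x \<in> S \<inter> W \<Longrightarrow> y \<in> S \<inter> W \<Longrightarrow> (\<forall>q\<in>osculating S x. B N q = 0) \<Longrightarrow> (\<forall>q\<in>osculating S y. B N q = 0)"
      using osculating_orthogonal_locally_constant[OF tg] by blast
    show "\<exists>T. openin (top_of_set I) T \<and> a \<in> T \<and>
        (\<forall>x\<in>T. \<forall>y\<in>T. (\<forall>q\<in>osculating S (\<alpha> x). B N q = 0) \<longrightarrow> (\<forall>q\<in>osculating S (\<alpha> y). B N q = 0))"
    proof (intro exI[of _ "I \<inter> \<alpha> -` W"] conjI ballI impI)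
      show "openin (top_of_set I) (I \<inter> \<alpha> -` W)"
        by (rule continuous_openin_preimage_gen[OF \<alpha>(1) W(1)])
      show "a \<in> I \<inter> \<alpha> -` W" using a W(2) by simp
      fix x y q assume "x \<in> I \<inter> \<alpha> -` W" "y \<in> I \<inter> \<alpha> -` W"
        "\<forall>q\<in>osculating S (\<alpha> x). B N q = 0" "q \<in> osculating S (\<alpha> y)"
      then show "B N q = 0"
        using W(3)[of "\<alpha> x" "\<alpha> y" N] \<alpha>(2) by blast
    qed
  qed
  moreover have "\<alpha> s \<in> osculating S (\<alpha> s)" for s
    unfolding osculating_def by (simp add: span_base)
  ultimately show ?thesis using N(1) that by blast
qed

text \<open>A constant normal vector \<open>N\<close> of the hyperplane has constant components \<open>a i\<close> along the frame,
  because \<open>n i'\<close> is a multiple of \<open>t\<close> and \<open>N\<close> is orthogonal to \<open>t\<close>. The relation is \<open>B N t' = 0\<close>,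
  expanded with \<open>B (n i) t' = \<kappa> i\<close>.\<close>

lemma curvature_relation_if_plane_curve:
  assumes dim: "DIM('a) = m + 2" and I: "parameter_interval I" and \<alpha>: "\<alpha> ` I \<subseteq> M"
    and C2: "C2_curve I \<alpha>"
    and frame: "rotation_minimizing_frame B M m I \<alpha> t n \<kappa>"
    and plane: "plane_curve B M (m + 1) I \<alpha>"
  shows "\<exists>a. (\<exists>i\<in>{1..m}. a i \<noteq> 0) \<and> (\<forall>s\<in>I. (\<Sum>i=1..m. a i * \<kappa> i s) = 0)"
proof -
  obtain k S where k: "k < m + 1" and tg: "totally_geodesic_submanifold B M k S" and \<alpha>S: "\<alpha> ` I \<subseteq> S"
    using plane unfolding plane_curve_def by blast
  have dt: "(\<alpha> has_vector_derivative t s) (at s within I)" if "s \<in> I" for s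
    using frame that unfolding rotation_minimizing_frame_def by blast
  then have "continuous_on I \<alpha>"
    using has_vector_derivative_continuous continuous_on_eq_continuous_within by blast
  then obtain N where N: "N \<noteq> 0" "\<And>s. s \<in> I \<Longrightarrow> B N (\<alpha> s) = 0"
    using totally_geodesic_curve_in_hyperplane[OF tg _ I _ \<alpha>S] k dim by auto
  have Nt: "B N (t s) = 0" if s: "s \<in> I" for s
    by (rule vector_derivative_of_constant[OF I s bounded_linear.has_vector_derivative[OF bounded_linear_right dt[OF s]]])
      (rule N(2))
  have dn: "(n i has_vector_derivative - \<kappa> i s *\<^sub>R t s) (at s within I)" if "s \<in> I" "i \<in> {1..m}" for i s
    by (rule frame_derivative[OF I \<alpha> frame that])
  have t_n: "B (t s) (n i s) = 0" if "s \<in> I" "i \<in> {1..m}" for s i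
    using frame that unfolding rotation_minimizing_frame_def by blast
  have n_t: "B (n i s) (t s) = 0" if "s \<in> I" "i \<in> {1..m}" for s i
    using t_n[OF that] sym[of "n i s"] by simp
  have t_t: "B (t s) (t s) = 1" if "s \<in> I" for s
    using frame that unfolding rotation_minimizing_frame_def by blast
  have n_n: "B (n i s) (n j s) = (if i = j then 1 else 0)" if "s \<in> I" "i \<in> {1..m}" "j \<in> {1..m}" for s i j
    using frame that unfolding rotation_minimizing_frame_def by blast
  have span: "span (insert (t s) ((\<lambda>i. n i s) ` {1..m})) = {v. B v (\<alpha> s) = 0}" if "s \<in> I" for s
  proof -
    have "\<alpha> s \<in> M" using \<alpha> that by blast
    with frame that show ?thesis
      unfolding rotation_minimizing_frame_def by (simp add: tangent_space_eq)
  qed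
  obtain s\<^sub>0 where s\<^sub>0: "s\<^sub>0 \<in> I"
    using I interior_subset by (fastforce simp: parameter_interval_def)
  define a where "a i = B N (n i s\<^sub>0)" for i
  have a: "B N (n i s) = a i" if s: "s \<in> I" and i: "i \<in> {1..m}" for i s
  proof -
    have "((\<lambda>s. B N (n i s)) has_vector_derivative 0) (at s within I)" if s: "s \<in> I" for s
      using bounded_linear.has_vector_derivative[OF bounded_linear_right[of N] dn[OF s i]] Nt[OF s] by (simp add: B_simps)
    moreover have "convex I" using I by (simp add: parameter_interval_def is_interval_convex)
    ultimately obtain c where "\<And>s. s \<in> I \<Longrightarrow> B N (n i s) = c"
      using has_vector_derivative_zero_constant by metis
    then show ?thesis using s s\<^sub>0 unfolding a_def by simp
  qed
  have expand: "N = (\<Sum>i=1..m. a i *\<^sub>R n i s)" if s: "s \<in> I" for s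
  proof (rule ccontr)
    define R where "R = N - (\<Sum>i=1..m. a i *\<^sub>R n i s)"
    assume "N \<noteq> (\<Sum>i=1..m. a i *\<^sub>R n i s)"
    then have "R \<noteq> 0" by (simp add: R_def)
    have Rt: "B R (t s) = 0"
      using Nt[OF s] n_t[OF s] unfolding R_def by (simp add: B_simps sum_left)
    have Rn: "B R (n j s) = 0" if j: "j \<in> {1..m}" for j
    proof -
      have "B (\<Sum>i=1..m. a i *\<^sub>R n i s) (n j s) = (\<Sum>i=1..m. if i = j then a j else 0)"
        unfolding sum_left scaleR_left by (intro sum.cong refl) (auto simp: n_n[OF s _ j])
      also have "\<dots> = a j" using j by simp
      finally show ?thesis using a[OF s j] by (simp add: R_def B_simps)
    qed
    have "n i s \<in> {v. B v (\<alpha> s) = 0}" if "i \<in> {1..m}" for i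
      using span[OF s] span_base that by (metis image_eqI insertCI)
    then have R\<alpha>: "B R (\<alpha> s) = 0"
      using N(2)[OF s] by (simp add: R_def B_simps sum_left)
    have "insert (t s) ((\<lambda>i. n i s) ` {1..m}) \<subseteq> {v. B R v = 0}"
      using Rt Rn by auto
    then have "span (insert (t s) ((\<lambda>i. n i s) ` {1..m})) \<subseteq> {v. B R v = 0}"
      by (rule span_minimal) (auto simp: subspace_def B_simps)
    then have "B R R = 0" using span[OF s] R\<alpha> by auto
    moreover have "\<alpha> s \<in> M" using \<alpha> s by blast
    ultimately show False using positive[OF _ R\<alpha> \<open>R \<noteq> 0\<close>] by simp
  qed
  have "\<exists>i\<in>{1..m}. a i \<noteq> 0"
  proof (rule ccontr)
    assume "\<not> (\<exists>i\<in>{1..m}. a i \<noteq> 0)"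
    then have "N = 0" using expand[OF s\<^sub>0] by (simp add: sum.neutral)
    with N(1) show False by blast
  qed
  moreover have "(\<Sum>i=1..m. a i * \<kappa> i s) = 0" if s: "s \<in> I" for s
  proof -
    obtain \<alpha>' \<alpha>'' where d1: "\<And>s. s \<in> I \<Longrightarrow> (\<alpha> has_vector_derivative \<alpha>' s) (at s within I)"
      and d2: "\<And>s. s \<in> I \<Longrightarrow> (\<alpha>' has_vector_derivative \<alpha>'' s) (at s within I)"
      using C2 unfolding C2_curve_def by blast
    have "t s = \<alpha>' s" if "s \<in> I" for s
      by (rule vector_derivative_unique_within[OF parameter_interval_nontrivial[OF I that] dt[OF that] d1[OF that]])
    then have t': "(t has_vector_derivative \<alpha>'' s) (at s within I)"
      using has_vector_derivative_transform[OF s _ d2[OF s], of t] by simp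
    have "B N (\<alpha>'' s) = 0"
      by (rule vector_derivative_of_constant[OF I s bounded_linear.has_vector_derivative[OF bounded_linear_right t']])
        (rule Nt)
    moreover have "B (n i s) (\<alpha>'' s) = \<kappa> i s" if i: "i \<in> {1..m}" for i
    proof -
      have "B (n i s) (\<alpha>'' s) + B (- \<kappa> i s *\<^sub>R t s) (t s) = 0"
        by (rule vector_derivative_of_constant[OF I s has_vector_derivative_form[OF dn[OF s i] t'], of 0])
          (rule n_t[OF _ i])
      then show ?thesis using t_t[OF s] by (simp add: B_simps)
    qed
    moreover have "B N (\<alpha>'' s) = (\<Sum>i=1..m. a i * B (n i s) (\<alpha>'' s))"
      by (subst expand[OF s]) (simp add: sum_left scaleR_left)
    ultimately show ?thesis by simp
  qed
  ultimately show ?thesis by blast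
qed

end

section \<open>The sphere and hyperbolic space\<close>

lemma space_form_sphere:
  assumes "r > 0"
  shows "space_form inner (sphere (0::'a::euclidean_space) r) UNIV (r\<^sup>2)"
proof (rule space_form.intro)
  show "bounded_bilinear (inner :: 'a \<Rightarrow> 'a \<Rightarrow> real)" by (rule bounded_bilinear_inner)
  show "sphere (0::'a) r = {q \<in> UNIV. q \<bullet> q = r\<^sup>2}"
    using assms by (auto simp: dot_square_norm)
qed (use assms in \<open>auto simp: inner_commute\<close>)

lemma lorentz_eq_inner: "lorentz i0 x y = x \<bullet> y - 2 * (x $ i0 * y $ i0)"
proof -
  have "x \<bullet> y = (\<Sum>i\<in>UNIV. x $ i * y $ i)" by (simp add: inner_vec_def)
  also have "\<dots> = x $ i0 * y $ i0 + (\<Sum>i\<in>UNIV - {i0}. x $ i * y $ i)"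
    by (rule sum.remove) auto
  finally show ?thesis by (simp add: lorentz_def)
qed

text \<open>The reverse Cauchy-Schwarz argument: for a time-like \<open>q\<close>, orthogonality expresses the time-like
  coordinate of \<open>v\<close> through the space-like ones, and the ordinary Cauchy-Schwarz inequality shows that it is
  dominated by them.\<close>

lemma lorentz_positive:
  fixes q v :: "real ^ 'n"
  assumes "lorentz i0 q q < 0" "lorentz i0 v q = 0" "v \<noteq> 0"
  shows "lorentz i0 v v > 0"
proof -
  let ?S = "UNIV - {i0}"
  have q: "(\<Sum>i\<in>?S. (q $ i)\<^sup>2) < (q $ i0)\<^sup>2"
    using assms(1) by (simp add: lorentz_def power2_eq_square)
  have vq: "v $ i0 * q $ i0 = (\<Sum>i\<in>?S. v $ i * q $ i)"
    using assms(2) by (simp add: lorentz_def)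
  have sq: "(v $ i0)\<^sup>2 * (q $ i0)\<^sup>2 \<le> (\<Sum>i\<in>?S. (v $ i)\<^sup>2) * (\<Sum>i\<in>?S. (q $ i)\<^sup>2)"
    using Cauchy_Schwarz_ineq_sum[of "\<lambda>i. v $ i" "\<lambda>i. q $ i" ?S] vq by (simp flip: power_mult_distrib)
  have vv: "lorentz i0 v v = (\<Sum>i\<in>?S. (v $ i)\<^sup>2) - (v $ i0)\<^sup>2"
    by (simp add: lorentz_def power2_eq_square)
  have q0: "(q $ i0)\<^sup>2 > 0" using q sum_nonneg[of ?S "\<lambda>i. (q $ i)\<^sup>2"] by auto
  have "(\<Sum>i\<in>?S. (v $ i)\<^sup>2) > 0"
  proof (rule ccontr)
    assume "\<not> ?thesis"
    then have 0: "(\<Sum>i\<in>?S. (v $ i)\<^sup>2) = 0"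
      using sum_nonneg[of ?S "\<lambda>i. (v $ i)\<^sup>2"] by fastforce
    with sq q0 have "v $ i0 = 0" by (simp add: mult_le_0_iff)
    moreover have "v $ i = 0" if "i \<in> ?S" for i
      using 0 that by (simp add: sum_nonneg_eq_0_iff)
    ultimately show False using assms(3) by (metis DiffI UNIV_I singletonD vec_eq_iff zero_index)
  qed
  with q have "(\<Sum>i\<in>?S. (v $ i)\<^sup>2) * (\<Sum>i\<in>?S. (q $ i)\<^sup>2) < (\<Sum>i\<in>?S. (v $ i)\<^sup>2) * (q $ i0)\<^sup>2"
    by simp
  with sq have "(v $ i0)\<^sup>2 * (q $ i0)\<^sup>2 < (\<Sum>i\<in>?S. (v $ i)\<^sup>2) * (q $ i0)\<^sup>2" by linarith
  then show ?thesis using q0 vv by simp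
qed

lemma space_form_hyperbolic:
  fixes i0 :: "'n::finite"
  assumes "r > 0"
  shows "space_form (lorentz i0) (hyperbolic_space i0 r) {q. q $ i0 > 0} (- r\<^sup>2)"
proof (rule space_form.intro)
  have "lorentz i0 = (\<lambda>x y. x \<bullet> (y - (2 * y $ i0) *\<^sub>R axis i0 1))"
    by (intro ext) (simp add: lorentz_eq_inner inner_diff_right inner_axis)
  moreover have "bounded_linear (\<lambda>y :: real ^ 'n. y - (2 * y $ i0) *\<^sub>R axis i0 1)"
    by (intro bounded_linear_sub bounded_linear_ident bounded_linear_compose[OF bounded_linear_scaleR_left]
        bounded_linear_const_mult bounded_linear_vec_nth)
  ultimately show "bounded_bilinear (lorentz i0)"
    using bounded_bilinear.comp[OF bounded_bilinear_inner bounded_linear_ident] by simp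
  show "lorentz i0 x y = lorentz i0 y x" for x y
    by (simp add: lorentz_def mult.commute)
  show "open {q :: real ^ 'n. q $ i0 > 0}"
    by (intro open_Collect_less continuous_intros)
  show "hyperbolic_space i0 r = {q \<in> {q. q $ i0 > 0}. lorentz i0 q q = - r\<^sup>2}"
    by (auto simp: hyperbolic_space_def)
  show "- r\<^sup>2 \<noteq> 0" using assms by simp
  show "lorentz i0 v v > 0" if "q \<in> hyperbolic_space i0 r" "lorentz i0 v q = 0" "v \<noteq> 0" for q v
    using lorentz_positive[OF _ that(2,3)] that(1) assms by (simp add: hyperbolic_space_def)
qed

theorem theorem6p3p2:
  fixes \<alpha> t :: "real \<Rightarrow> real ^ 'n" and n :: "nat \<Rightarrow> real \<Rightarrow> real ^ 'n"
    and \<kappa> :: "nat \<Rightarrow> real \<Rightarrow> real" and I :: "real set"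
    and B :: "real ^ 'n \<Rightarrow> real ^ 'n \<Rightarrow> real" and M :: "(real ^ 'n) set"
    and i0 :: 'n and r :: real and m :: nat
  assumes "CARD('n) = m + 2" and "r > 0"
    and "B = inner \<and> M = sphere 0 r \<or> B = lorentz i0 \<and> M = hyperbolic_space i0 r"
    and "parameter_interval I" and "\<alpha> ` I \<subseteq> M" and "C2_curve I \<alpha>" and "unit_speed B I \<alpha>"
    and "rotation_minimizing_frame B M m I \<alpha> t n \<kappa>"
  shows "plane_curve B M (m + 1) I \<alpha> \<longleftrightarrow>
    (\<exists>a :: nat \<Rightarrow> real. (\<exists>i\<in>{1..m}. a i \<noteq> 0) \<and> (\<forall>s\<in>I. (\<Sum>i=1..m. a i * \<kappa> i s) = 0))"
proof -
  have "\<exists>\<Omega> \<beta>. space_form B M \<Omega> \<beta>"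
    using assms(3) space_form_sphere[OF assms(2)] space_form_hyperbolic[OF assms(2)] by blast
  then obtain \<Omega> \<beta> where "space_form B M \<Omega> \<beta>" by blast
  then interpret space_form B M \<Omega> \<beta> .
  have dim: "DIM(real ^ 'n) = m + 2" using assms(1) by simp
  show ?thesis
    using curvature_relation_if_plane_curve[OF dim assms(4,5,6,8)]
      plane_curve_if_curvature_relation[OF dim assms(4,5,8)] by blast
qed

end
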